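(* Let $n\ge2$, let $F$ be a field of characteristic zero, let $\mathfrak g$ be a finite-dimensional $n$-Lie algebra over $F$ with $n$-Lie bracket $\mu:\mathfrak g^{\otimes n}\to\mathfrak g$, and let $\gamma:\mathfrak g\to\mathfrak g^{\otimes n}$ be a linear map such that $(\mathfrak g,\gamma)$ is an $n$-Lie bialgebra. Equip $\mathfrak g^*$ with the $n$-Lie bracket $[\cdot,\dots,\cdot]_{\mathfrak g^*}={}^t\gamma$ induced by $\gamma$. Then $(\mathfrak g^*,{}^t\mu)$ is an $n$-Lie bialgebra, where ${}^t\mu:\mathfrak g^*\to(\mathfrak g^* )^{\otimes n}$ is the transpose of $\mu$.
   Context: **$n$-Lie algebra.** A vector space $\mathfrak g$ with a skew-symmetric $n$-linear bracket satisfying, for all elements, $[x_1,\dots,x_{n-1},[y_1,\dots,y_n]]=\sum_{i=1}^n[y_1,\dots,y_{i-1},[x_1,\dots,x_{n-1},y_i],y_{i+1},\dots,y_n]$. Put $\mathrm{ad}_{x_1,\dots,x_{n-1}}(y)=[x_1,\dots,x_{n-1},y]$. **$n$-Lie bialgebra.** An $n$-Lie algebra $\mathfrak g$ with a linear map $\gamma:\mathfrak g\to\mathfrak g^{\otimes n}$ such that: (i) the transpose ${}^t\gamma:(\mathfrak g^* )^{\otimes n}\to\mathfrak g^*$, $\langle{}^t\gamma(\xi_1\otimes\cdots\otimes\xi_n),x\rangle=\langle\xi_1\otimes\cdots\otimes\xi_n,\gamma(x)\rangle$ (factorwise pairing), is an $n$-Lie bracket on $\mathfrak g^*$; (ii)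 $\gamma$ is a $1$-cocycle with values in $\mathfrak g^{\otimes n}$, meaning that for all $x_1,\dots,x_n\in\mathfrak g$, $$\gamma([x_1,\dots,x_n])=\sum_{i=1}^n(-1)^{n-i}\,\mathrm{ad}^{(n)}_{x_1,\dots,\hat{x_i},\dots,x_n}(\gamma(x_i)),$$ where the hat denotes omission and $\mathrm{ad}^{(n)}_{X}(y_1\otimes\cdots\otimes y_n)=\sum_{j=1}^n y_1\otimes\cdots\otimes\mathrm{ad}_X(y_j)\otimes\cdots\otimes y_n$. Here $\mathfrak g^{**}$ is identified with $\mathfrak g$ and $((\mathfrak g)^{\otimes n})^*$ with $(\mathfrak g^* )^{\otimes n}$. *)

theory Defs
  imports Complex_Main "HOL-Combinatorics.Permutations" "HOL-Library.Function_Algebras"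
begin

text \<open>
  Vector spaces are subspaces \<open>V\<close> of an ambient type that carries a scalar multiplication
  \<open>s\<close> with \<open>vector_space s\<close>. Duals and tensor powers then live in function types, with the
  pointwise addition of \<open>HOL-Library.Function_Algebras\<close> and the following scalar multiplication.
  Tuples are lists, so positions are counted from 0.
\<close>

definition fscale :: "'f::field \<Rightarrow> ('b \<Rightarrow> 'f) \<Rightarrow> 'b \<Rightarrow> 'f" where
  "fscale c f = (\<lambda>x. c * f x)"

definition tuples :: "nat \<Rightarrow> 'a set \<Rightarrow> 'a list set" where
  "tuples n V = {xs. length xs = n \<and> set xs \<subseteq> V}"

definition linear_on ::
  "('f::field \<Rightarrow> 'a::ab_group_add \<Rightarrow> 'a) \<Rightarrow> 'a set \<Rightarrow> ('f \<Rightarrow> 'b::ab_group_add \<Rightarrow> 'b) \<Rightarrow> 'b set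
    \<Rightarrow> ('a \<Rightarrow> 'b) \<Rightarrow> bool" where
  "linear_on s V t W f \<longleftrightarrow>
     (\<forall>x\<in>V. f x \<in> W) \<and>
     (\<forall>x\<in>V. \<forall>y\<in>V. f (x + y) = f x + f y) \<and>
     (\<forall>c. \<forall>x\<in>V. f (s c x) = t c (f x))"

definition multilinear_on ::
  "nat \<Rightarrow> ('f::field \<Rightarrow> 'a::ab_group_add \<Rightarrow> 'a) \<Rightarrow> 'a set
    \<Rightarrow> ('f \<Rightarrow> 'b::ab_group_add \<Rightarrow> 'b) \<Rightarrow> 'b set \<Rightarrow> ('a list \<Rightarrow> 'b) \<Rightarrow> bool" where
  "multilinear_on n s V t W f \<longleftrightarrow>
     (\<forall>xs\<in>tuples n V. \<forall>i<n. linear_on s V t W (\<lambda>x. f (xs[i := x])))"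

text \<open>Functionals are extended by 0 outside \<open>V\<close>, so that equal functionals are equal functions.\<close>

definition dual_space :: "('f::field \<Rightarrow> 'a::ab_group_add \<Rightarrow> 'a) \<Rightarrow> 'a set \<Rightarrow> ('a \<Rightarrow> 'f) set" where
  "dual_space s V = {\<xi>. linear_on s V (*) UNIV \<xi> \<and> (\<forall>x. x \<notin> V \<longrightarrow> \<xi> x = 0)}"

definition dual_map :: "'a set \<Rightarrow> ('a \<Rightarrow> 'b) \<Rightarrow> ('b \<Rightarrow> 'f::field) \<Rightarrow> 'a \<Rightarrow> 'f" where
  "dual_map V f \<eta> = (\<lambda>x. if x \<in> V then \<eta> (f x) else 0)"

text \<open>
  The tensor power \<open>V\<^sup>\<otimes>\<^sup>n\<close> is realised inside the dual of the space of multilinear forms on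
  \<open>V\<^sup>n\<close>: the pure tensor of \<open>xs\<close> is evaluation at \<open>xs\<close>, and the tensor power is
  the span of the pure tensors. Lemma \<open>tensor_power_universal\<close> below is the universal property.
\<close>

definition pure_tensor ::
  "nat \<Rightarrow> ('f::field \<Rightarrow> 'a::ab_group_add \<Rightarrow> 'a) \<Rightarrow> 'a set \<Rightarrow> 'a list \<Rightarrow> ('a list \<Rightarrow> 'f) \<Rightarrow> 'f" where
  "pure_tensor n s V xs = (\<lambda>\<phi>. if multilinear_on n s V (*) UNIV \<phi> then \<phi> xs else 0)"

definition tensor_power ::
  "nat \<Rightarrow> ('f::field \<Rightarrow> 'a::ab_group_add \<Rightarrow> 'a) \<Rightarrow> 'a set \<Rightarrow> (('a list \<Rightarrow> 'f) \<Rightarrow> 'f) set" where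
  "tensor_power n s V = module.span fscale (pure_tensor n s V ` tuples n V)"

text \<open>
  The factorwise pairing of \<open>(V\<^sup>*)\<^sup>\<otimes>\<^sup>n\<close> with \<open>V\<^sup>\<otimes>\<^sup>n\<close> (see \<open>pairing_pure\<close>), and the resulting
  identification of \<open>(V\<^sup>*)\<^sup>\<otimes>\<^sup>n\<close> with \<open>(V\<^sup>\<otimes>\<^sup>n)\<^sup>*\<close>, which is bijective for
  finite-dimensional \<open>V\<close> (\<open>tensor_dual_bij\<close>).
\<close>

definition pairing ::
  "nat \<Rightarrow> ((('a \<Rightarrow> 'f::field) list \<Rightarrow> 'f) \<Rightarrow> 'f) \<Rightarrow> (('a list \<Rightarrow> 'f) \<Rightarrow> 'f) \<Rightarrow> 'f" where
  "pairing n S T = S (\<lambda>\<xi>s. T (\<lambda>xs. \<Prod>i<n. (\<xi>s ! i) (xs ! i)))"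

definition tensor_dual ::
  "nat \<Rightarrow> ('f::field \<Rightarrow> 'a::ab_group_add \<Rightarrow> 'a) \<Rightarrow> 'a set
    \<Rightarrow> ((('a \<Rightarrow> 'f) list \<Rightarrow> 'f) \<Rightarrow> 'f) \<Rightarrow> (('a list \<Rightarrow> 'f) \<Rightarrow> 'f) \<Rightarrow> 'f" where
  "tensor_dual n s V S = (\<lambda>T. if T \<in> tensor_power n s V then pairing n S T else 0)"

definition transpose_cobracket ::
  "nat \<Rightarrow> ('f::field \<Rightarrow> 'a::ab_group_add \<Rightarrow> 'a) \<Rightarrow> 'a set
    \<Rightarrow> ('a \<Rightarrow> ('a list \<Rightarrow> 'f) \<Rightarrow> 'f) \<Rightarrow> ((('a \<Rightarrow> 'f) list \<Rightarrow> 'f) \<Rightarrow> 'f) \<Rightarrow> 'a \<Rightarrow> 'f" where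
  "transpose_cobracket n s V \<gamma> S = dual_map V \<gamma> (tensor_dual n s V S)"

definition transpose_bracket ::
  "nat \<Rightarrow> ('f::field \<Rightarrow> 'a::ab_group_add \<Rightarrow> 'a) \<Rightarrow> 'a set
    \<Rightarrow> ((('a list \<Rightarrow> 'f) \<Rightarrow> 'f) \<Rightarrow> 'a) \<Rightarrow> ('a \<Rightarrow> 'f) \<Rightarrow> (('a \<Rightarrow> 'f) list \<Rightarrow> 'f) \<Rightarrow> 'f" where
  "transpose_bracket n s V \<mu> \<xi> =
     inv_into (tensor_power n fscale (dual_space s V)) (tensor_dual n s V)
       (dual_map (tensor_power n s V) \<mu> \<xi>)"

definition n_lie_algebra ::
  "nat \<Rightarrow> ('f::field \<Rightarrow> 'a::ab_group_add \<Rightarrow> 'a) \<Rightarrow> 'a set \<Rightarrow> ('a list \<Rightarrow> 'a) \<Rightarrow> bool" where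
  "n_lie_algebra n s V br \<longleftrightarrow>
     vector_space s \<and> module.subspace s V \<and>
     multilinear_on n s V s V br \<and>
     (\<forall>xs\<in>tuples n V. \<forall>p. p permutes {..<n} \<longrightarrow>
        br (permute_list p xs) = s (of_int (sign p)) (br xs)) \<and>
     (\<forall>xs\<in>tuples (n - 1) V. \<forall>ys\<in>tuples n V.
        br (xs @ [br ys]) = (\<Sum>i<n. br (ys[i := br (xs @ [ys ! i])])))"

text \<open>
  The action \<open>y\<^sub>1 \<otimes> \<dots> \<otimes> y\<^sub>n \<mapsto> \<Sum>\<^sub>j y\<^sub>1 \<otimes> \<dots> \<otimes> D y\<^sub>j \<otimes> \<dots> \<otimes> y\<^sub>n\<close> on the tensor power of a
  linear map \<open>D\<close>, written as a precomposition of multilinear forms (see \<open>tensor_action_pure\<close>).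
\<close>

definition tensor_action ::
  "nat \<Rightarrow> ('f::field \<Rightarrow> 'a::ab_group_add \<Rightarrow> 'a) \<Rightarrow> 'a set \<Rightarrow> ('a \<Rightarrow> 'a)
    \<Rightarrow> (('a list \<Rightarrow> 'f) \<Rightarrow> 'f) \<Rightarrow> ('a list \<Rightarrow> 'f) \<Rightarrow> 'f" where
  "tensor_action n s V D T =
     (\<lambda>\<phi>. if multilinear_on n s V (*) UNIV \<phi>
          then \<Sum>j<n. T (\<lambda>ys. \<phi> (ys[j := D (ys ! j)])) else 0)"

text \<open>
  In the cocycle condition the index \<open>i\<close> starts at 0, hence the sign \<open>(-1)\<^sup>n\<^sup>-\<^sup>1\<^sup>-\<^sup>i\<close>.
\<close>

definition n_lie_bialgebra ::
  "nat \<Rightarrow> ('f::field \<Rightarrow> 'a::ab_group_add \<Rightarrow> 'a) \<Rightarrow> 'a set \<Rightarrow> ('a list \<Rightarrow> 'a)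
    \<Rightarrow> ('a \<Rightarrow> ('a list \<Rightarrow> 'f) \<Rightarrow> 'f) \<Rightarrow> bool" where
  "n_lie_bialgebra n s V br \<gamma> \<longleftrightarrow>
     n_lie_algebra n s V br \<and>
     linear_on s V fscale (tensor_power n s V) \<gamma> \<and>
     n_lie_algebra n fscale (dual_space s V)
       (\<lambda>\<xi>s. transpose_cobracket n s V \<gamma> (pure_tensor n fscale (dual_space s V) \<xi>s)) \<and>
     (\<forall>xs\<in>tuples n V.
        \<gamma> (br xs) =
          (\<Sum>i<n. fscale ((-1) ^ (n - Suc i))
             (tensor_action n s V (\<lambda>y. br (take i xs @ drop (Suc i) xs @ [y])) (\<gamma> (xs ! i)))))"

section \<open>Adequacy of the tensor constructions\<close>

lemma vector_space_fscale: "vector_space fscale"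
  by unfold_locales (auto simp: fscale_def fun_eq_iff algebra_simps)

lemma vector_space_times: "vector_space ((*) :: 'f::field \<Rightarrow> 'f \<Rightarrow> 'f)"
  by unfold_locales (auto simp: algebra_simps)

lemma tuples_update: "xs \<in> tuples n V \<Longrightarrow> x \<in> V \<Longrightarrow> xs[i := x] \<in> tuples n V"
  using set_update_subset_insert[of xs i x] by (auto simp: tuples_def)

lemma multilinear_on_mem:
  assumes "multilinear_on n s V t W f" "xs \<in> tuples n V" "0 < n"
  shows "f xs \<in> W"
proof -
  have "xs ! 0 \<in> V" using assms by (auto simp: tuples_def)
  moreover have "linear_on s V t W (\<lambda>x. f (xs[0 := x]))"
    using assms by (auto simp: multilinear_on_def)
  ultimately have "f (xs[0 := xs ! 0]) \<in> W" unfolding linear_on_def by blast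
  then show ?thesis by simp
qed

lemma multilinear_on_comp_linear:
  assumes "multilinear_on n s V t W f" "linear_on t W u X h"
  shows "multilinear_on n s V u X (\<lambda>xs. h (f xs))"
  unfolding multilinear_on_def
proof (intro ballI allI impI)
  fix xs i assume "xs \<in> tuples n V" "i < n"
  then have "linear_on s V t W (\<lambda>x. f (xs[i := x]))"
    using assms(1) by (auto simp: multilinear_on_def)
  with assms(2) show "linear_on s V u X (\<lambda>x. h (f (xs[i := x])))"
    by (auto simp: linear_on_def)
qed

lemma multilinear_on_precomp:
  assumes f: "multilinear_on n s V t W f" and D: "linear_on s V s V D" and "j < n"
  shows "multilinear_on n s V t W (\<lambda>ys. f (ys[j := D (ys ! j)]))"
  unfolding multilinear_on_def
proof (intro ballI allI impI)
  fix xs i assume xs: "xs \<in> tuples n V" and i: "i < n"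
  have len: "length xs = n" using xs by (simp add: tuples_def)
  have xj: "D (xs ! j) \<in> V"
    using xs D \<open>j < n\<close> by (auto simp: tuples_def linear_on_def intro: nth_mem subsetD)
  show "linear_on s V t W (\<lambda>x. f (xs[i := x, j := D (xs[i := x] ! j)]))"
  proof (cases "i = j")
    case True
    have "linear_on s V t W (\<lambda>x. f (xs[j := x]))"
      using f xs \<open>j < n\<close> by (auto simp: multilinear_on_def)
    with D True len \<open>j < n\<close> show ?thesis
      by (auto simp: linear_on_def)
  next
    case False
    have "linear_on s V t W (\<lambda>x. f ((xs[j := D (xs ! j)])[i := x]))"
      using f tuples_update[OF xs xj] i by (auto simp: multilinear_on_def)
    with False show ?thesis
      by (simp add: list_update_swap)
  qed
qed

lemma multilinear_on_prod_functionals: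
  assumes "\<xi>s \<in> tuples n (dual_space s V)"
  shows "multilinear_on n s V (*) UNIV (\<lambda>xs. \<Prod>i<n. (\<xi>s ! i) (xs ! i))"
  unfolding multilinear_on_def
proof (intro ballI allI impI)
  fix xs i assume xs: "xs \<in> tuples n V" and i: "i < n"
  have len: "length xs = n" using xs by (simp add: tuples_def)
  have "\<xi>s ! i \<in> dual_space s V" using assms i by (auto simp: tuples_def)
  then have lin: "linear_on s V (*) UNIV (\<xi>s ! i)" by (simp add: dual_space_def)
  have eq: "(\<Prod>k<n. (\<xi>s ! k) (xs[i := x] ! k)) =
      (\<xi>s ! i) x * (\<Prod>k\<in>{..<n} - {i}. (\<xi>s ! k) (xs ! k))" for x
    using i len by (subst prod.remove[of _ i]) (auto intro!: prod.cong)
  show "linear_on s V (*) UNIV (\<lambda>x. \<Prod>k<n. (\<xi>s ! k) (xs[i := x] ! k))"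
    using lin unfolding eq linear_on_def by (auto simp: algebra_simps)
qed

lemma multilinear_on_prod_arguments:
  assumes "xs \<in> tuples n V"
  shows "multilinear_on n fscale (dual_space s V) (*) UNIV (\<lambda>\<xi>s. \<Prod>i<n. (\<xi>s ! i) (xs ! i))"
  unfolding multilinear_on_def
proof (intro ballI allI impI)
  fix \<xi>s i assume xs: "\<xi>s \<in> tuples n (dual_space s V)" and i: "i < n"
  have len: "length \<xi>s = n" using xs by (simp add: tuples_def)
  have eq: "(\<Prod>k<n. (\<xi>s[i := \<xi>] ! k) (xs ! k)) =
      \<xi> (xs ! i) * (\<Prod>k\<in>{..<n} - {i}. (\<xi>s ! k) (xs ! k))" for \<xi>
    using i len by (subst prod.remove[of _ i]) (auto intro!: prod.cong)
  show "linear_on fscale (dual_space s V) (*) UNIV (\<lambda>\<xi>. \<Prod>k<n. (\<xi>s[i := \<xi>] ! k) (xs ! k))"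
    unfolding eq linear_on_def by (auto simp: algebra_simps fscale_def)
qed

lemma pairing_pure:
  assumes xs: "xs \<in> tuples n V" and \<xi>s: "\<xi>s \<in> tuples n (dual_space s V)"
  shows "pairing n (pure_tensor n fscale (dual_space s V) \<xi>s) (pure_tensor n s V xs) =
         (\<Prod>i<n. (\<xi>s ! i) (xs ! i))"
proof -
  let ?g = "\<lambda>\<xi>s. pure_tensor n s V xs (\<lambda>xs. \<Prod>i<n. (\<xi>s ! i) (xs ! i))"
  have g: "?g \<eta>s = (\<Prod>i<n. (\<eta>s ! i) (xs ! i))" if "\<eta>s \<in> tuples n (dual_space s V)" for \<eta>s
    using multilinear_on_prod_functionals[OF that] by (simp add: pure_tensor_def)
  have closed: "(\<lambda>x. \<xi> x + \<eta> x) \<in> dual_space s V" "fscale c \<xi> \<in> dual_space s V"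
    if "\<xi> \<in> dual_space s V" "\<eta> \<in> dual_space s V" for \<xi> \<eta> c
    using that by (auto simp: dual_space_def linear_on_def fscale_def algebra_simps)
  have "multilinear_on n fscale (dual_space s V) (*) UNIV ?g"
    unfolding multilinear_on_def
  proof (intro ballI allI impI)
    fix \<eta>s i assume \<eta>s: "\<eta>s \<in> tuples n (dual_space s V)" and i: "i < n"
    have "linear_on fscale (dual_space s V) (*) UNIV (\<lambda>\<xi>. \<Prod>k<n. (\<eta>s[i := \<xi>] ! k) (xs ! k))"
      using multilinear_on_prod_arguments[OF xs] \<eta>s i by (auto simp: multilinear_on_def)
    then show "linear_on fscale (dual_space s V) (*) UNIV (\<lambda>\<xi>. ?g (\<eta>s[i := \<xi>]))"
      using closed unfolding linear_on_def
      by (auto simp: g tuples_update[OF \<eta>s] plus_fun_def)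
  qed
  then show ?thesis
    unfolding pairing_def by (subst (1) pure_tensor_def) (simp add: g[OF \<xi>s])
qed

lemma tensor_action_pure:
  fixes s :: "'f::field \<Rightarrow> 'a::ab_group_add \<Rightarrow> 'a"
  assumes "linear_on s V s V D"
  shows "tensor_action n s V D (pure_tensor n s V ys) =
         (\<Sum>j<n. pure_tensor n s V (ys[j := D (ys ! j)]))"
proof
  have sum_apply: "(\<Sum>j\<in>A. F j) \<phi> = (\<Sum>j\<in>A. F j \<phi>)"
    for A :: "nat set" and F :: "nat \<Rightarrow> ('a list \<Rightarrow> 'f) \<Rightarrow> 'f" and \<phi>
    by (induction A rule: infinite_finite_induct) auto
  fix \<phi>
  have "multilinear_on n s V (*) UNIV (\<lambda>ys. \<phi> (ys[j := D (ys ! j)]))"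
    if "multilinear_on n s V (*) UNIV \<phi>" "j < n" for j
    using multilinear_on_precomp[OF that(1) assms that(2)] .
  then show "tensor_action n s V D (pure_tensor n s V ys) \<phi> =
        (\<Sum>j<n. pure_tensor n s V (ys[j := D (ys ! j)])) \<phi>"
    by (simp add: sum_apply tensor_action_def pure_tensor_def)
qed

lemma multilinear_pure_tensor:
  "multilinear_on n s V fscale (tensor_power n s V) (pure_tensor n s V)"
  unfolding multilinear_on_def
proof (intro ballI allI impI)
  fix xs i assume xs: "xs \<in> tuples n V" and i: "i < n"
  interpret vector_space fscale by (rule vector_space_fscale)
  show "linear_on s V fscale (tensor_power n s V) (\<lambda>x. pure_tensor n s V (xs[i := x]))"
    unfolding linear_on_def tensor_power_def
  proof (intro conjI ballI allI)
    fix x assume "x \<in> V"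
    with xs show "pure_tensor n s V (xs[i := x]) \<in> span (pure_tensor n s V ` tuples n V)"
      by (intro span_base imageI tuples_update)
  qed (use xs i in \<open>auto simp: pure_tensor_def fscale_def fun_eq_iff multilinear_on_def linear_on_def\<close>)
qed

lemma tensor_power_universal:
  fixes s :: "'f::field \<Rightarrow> 'a::ab_group_add \<Rightarrow> 'a" and t :: "'f \<Rightarrow> 'b::ab_group_add \<Rightarrow> 'b"
  assumes t: "vector_space t" and W: "module.subspace t W" and n: "0 < n"
    and f: "multilinear_on n s V t W f"
  shows "\<exists>F. linear_on fscale (tensor_power n s V) t W F \<and>
             (\<forall>xs\<in>tuples n V. F (pure_tensor n s V xs) = f xs)"
proof -
  interpret P: vector_space "fscale :: 'f \<Rightarrow> (('a list \<Rightarrow> 'f) \<Rightarrow> 'f) \<Rightarrow> _"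
    by (rule vector_space_fscale)
  interpret T: vector_space t by (rule t)
  interpret K: vector_space "(*) :: 'f \<Rightarrow> 'f \<Rightarrow> 'f" by (rule vector_space_times)
  interpret PT: vector_space_pair "fscale :: 'f \<Rightarrow> (('a list \<Rightarrow> 'f) \<Rightarrow> 'f) \<Rightarrow> _" t ..
  interpret TK: vector_space_pair t "(*) :: 'f \<Rightarrow> 'f \<Rightarrow> 'f" ..
  let ?pt = "pure_tensor n s V"
  let ?X = "?pt ` tuples n V"
  obtain B where B: "B \<subseteq> ?X" "P.independent B" "?X \<subseteq> P.span B"
    by (rule P.maximal_independent_subset)
  define r where "r = inv_into (tuples n V) ?pt"
  have r: "r b \<in> tuples n V" "?pt (r b) = b" if "b \<in> B" for b
    using that B(1) unfolding r_def by (auto intro: inv_into_into f_inv_into_f)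
  obtain F where F: "Vector_Spaces.linear fscale t F" "\<And>b. b \<in> B \<Longrightarrow> F b = f (r b)"
    using PT.linear_independent_extend[OF B(2), of "f \<circ> r"] by auto
  interpret F: Vector_Spaces.linear fscale t F by (rule F(1))
  have pure: "F (?pt xs) = f xs" if xs: "xs \<in> tuples n V" for xs
  proof (rule ccontr)
    assume neq: "F (?pt xs) \<noteq> f xs"
    have "?pt xs \<in> P.span B" using B(3) xs by auto
    then obtain A c where A: "finite A" "A \<subseteq> B" "?pt xs = (\<Sum>a\<in>A. fscale (c a) a)"
      unfolding P.span_explicit by auto
    let ?w = "f xs - F (?pt xs)"
    have "T.independent {?w}" using neq by simp
    then obtain l where l: "Vector_Spaces.linear t (*) l" "l ?w = 1"
      using TK.linear_independent_extend[of "{?w}" "\<lambda>_. 1"] by auto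
    interpret l: Vector_Spaces.linear t "(*)" l by (rule l(1))
    have "linear_on t W (*) UNIV l" by (auto simp: linear_on_def l.add l.scale)
    then have m: "multilinear_on n s V (*) UNIV (\<lambda>xs. l (f xs))"
      by (rule multilinear_on_comp_linear[OF f])
    have app: "(\<Sum>a\<in>A. fscale (c a) a) \<phi> = (\<Sum>a\<in>A. c a * a \<phi>)" for \<phi>
      using A(1) by (induction A) (auto simp: fscale_def)
    have "l (f xs) = ?pt xs (\<lambda>xs. l (f xs))" using m by (simp add: pure_tensor_def)
    also have "\<dots> = (\<Sum>a\<in>A. c a * a (\<lambda>xs. l (f xs)))" by (simp add: A(3) app)
    also have "\<dots> = (\<Sum>a\<in>A. c a * l (f (r a)))"
    proof (rule sum.cong)
      fix a assume "a \<in> A"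
      then have "a = ?pt (r a)" using r A(2) by auto
      then have "a (\<lambda>xs. l (f xs)) = ?pt (r a) (\<lambda>xs. l (f xs))" by simp
      then show "c a * a (\<lambda>xs. l (f xs)) = c a * l (f (r a))"
        using m by (simp add: pure_tensor_def)
    qed simp
    also have "\<dots> = l (F (?pt xs))"
      unfolding A(3) F.sum F.scale l.sum l.scale
      using A(2) F(2) by (intro sum.cong) auto
    finally show False using l(2) by (simp add: l.diff)
  qed
  have "F T \<in> W" if "T \<in> tensor_power n s V" for T
    using that unfolding tensor_power_def
  proof (induction rule: P.span_induct_alt)
    case base
    show ?case by (subst F.zero) (rule T.subspace_0[OF W])
  next
    case (step c x y)
    then have "F x \<in> W" using pure multilinear_on_mem[OF f _ n] by auto
    then show ?case
      unfolding F.add F.scale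
      by (intro T.subspace_add[OF W] T.subspace_scale[OF W] step)
  qed
  then have "linear_on fscale (tensor_power n s V) t W F"
    by (auto simp: linear_on_def F.add F.scale)
  with pure show "\<exists>F. linear_on fscale (tensor_power n s V) t W F \<and>
      (\<forall>xs\<in>tuples n V. F (pure_tensor n s V xs) = f xs)" by blast
qed

lemma tensor_power_linear_eqI:
  fixes s :: "'f::field \<Rightarrow> 'a::ab_group_add \<Rightarrow> 'a" and t :: "'f \<Rightarrow> 'b::ab_group_add \<Rightarrow> 'b"
  assumes t: "vector_space t"
    and F: "linear_on fscale (tensor_power n s V) t W F"
    and G: "linear_on fscale (tensor_power n s V) t W G"
    and eq: "\<And>xs. xs \<in> tuples n V \<Longrightarrow> F (pure_tensor n s V xs) = G (pure_tensor n s V xs)"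
    and "T \<in> tensor_power n s V"
  shows "F T = G T"
proof -
  interpret P: vector_space "fscale :: 'f \<Rightarrow> (('a list \<Rightarrow> 'f) \<Rightarrow> 'f) \<Rightarrow> _"
    by (rule vector_space_fscale)
  interpret T: vector_space t by (rule t)
  let ?X = "pure_tensor n s V ` tuples n V"
  from \<open>T \<in> tensor_power n s V\<close> have "T \<in> P.span ?X" by (simp add: tensor_power_def)
  then have "T \<in> P.span ?X \<and> F T = G T"
  proof (induction rule: P.span_induct_alt)
    case base
    have "fscale 0 0 = (0 :: ('a list \<Rightarrow> 'f) \<Rightarrow> 'f)" by simp
    with F G P.span_zero[of ?X] show ?case
      unfolding linear_on_def tensor_power_def by (metis T.scale_zero_left)
  next
    case (step c x y)
    have x: "x \<in> P.span ?X" using step by (auto intro: P.span_base)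
    have "F (fscale c x + y) = t c (F x) + F y" "G (fscale c x + y) = t c (G x) + G y"
      using F G x step P.span_scale[OF x, of c]
      unfolding linear_on_def tensor_power_def by auto
    moreover have "fscale c x + y \<in> P.span ?X"
      using step by (intro P.span_add P.span_scale x) simp
    moreover have "F x = G x" using eq step by auto
    ultimately show ?case using step by metis
  qed
  then show "F T = G T" by simp
qed

lemma multilinear_on_eqI:
  fixes s :: "'f::field \<Rightarrow> 'a::ab_group_add \<Rightarrow> 'a" and t :: "'f \<Rightarrow> 'b::ab_group_add \<Rightarrow> 'b"
  assumes s: "vector_space s" and t: "vector_space t" and V: "V = module.span s B"
    and f: "multilinear_on n s V t W f" and g: "multilinear_on n s V t W g"
    and eq: "\<And>xs. xs \<in> tuples n B \<Longrightarrow> f xs = g xs"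
    and xs: "xs \<in> tuples n V"
  shows "f xs = g xs"
proof -
  interpret S: vector_space s by (rule s)
  interpret T: vector_space t by (rule t)
  have B: "B \<subseteq> V" unfolding V by (rule S.span_superset)
  have "f xs = g xs" if "k \<le> n" "xs \<in> tuples n V" "\<forall>i. k \<le> i \<and> i < n \<longrightarrow> xs ! i \<in> B" for k xs
    using that
  proof (induction k arbitrary: xs)
    case 0
    then have "xs \<in> tuples n B" by (auto simp: tuples_def in_set_conv_nth)
    then show ?case by (rule eq)
  next
    case (Suc k)
    have k: "k < n" "k \<le> n" and len: "length xs = n" using Suc.prems by (auto simp: tuples_def)
    have lf: "linear_on s V t W (\<lambda>x. f (xs[k := x]))" and lg: "linear_on s V t W (\<lambda>x. g (xs[k := x]))"
      using f g Suc.prems k by (auto simp: multilinear_on_def)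
    have base: "f (xs[k := x]) = g (xs[k := x])" if "x \<in> B" for x
    proof (rule Suc.IH)
      show "xs[k := x] \<in> tuples n V" using that B Suc.prems by (auto intro: tuples_update)
      show "\<forall>i. k \<le> i \<and> i < n \<longrightarrow> xs[k := x] ! i \<in> B"
        using that Suc.prems(3) len by (auto simp: nth_list_update)
    qed (rule k(2))
    have "xs ! k \<in> S.span B" using Suc.prems k len V by (auto simp: tuples_def intro: nth_mem subsetD)
    then have "xs ! k \<in> V \<and> f (xs[k := xs ! k]) = g (xs[k := xs ! k])"
    proof (induction rule: S.span_induct_alt)
      case base
      have "s 0 0 = 0" by (rule S.scale_zero_left)
      then show ?case using lf lg S.span_zero[of B] unfolding linear_on_def V
        by (metis T.scale_zero_left)
    next
      case (step c x y)
      have x: "x \<in> V" "s c x \<in> V" using step B by (auto simp: V intro: S.span_base S.span_scale)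
      moreover have "s c x + y \<in> V" using x step by (auto simp: V intro: S.span_add)
      ultimately show ?case using step lf lg base[OF step(1)] by (simp add: linear_on_def)
    qed
    then show ?case by simp
  qed
  moreover have "\<forall>i. n \<le> i \<and> i < n \<longrightarrow> xs ! i \<in> B" by auto
  ultimately show ?thesis using xs by blast
qed

lemma fscale_apply: "fscale c f x = c * f x"
  by (simp add: fscale_def)

lemma sum_fun_apply: "(\<Sum>a\<in>A. F a) x = (\<Sum>a\<in>A. F a x)" for F :: "'c \<Rightarrow> 'b \<Rightarrow> 'd::comm_monoid_add"
  by (induction A rule: infinite_finite_induct) auto

lemma linear_on_combination:
  assumes "vector_space t" "\<And>a. a \<in> A \<Longrightarrow> linear_on s V t UNIV (F a)"
  shows "linear_on s V t UNIV (\<lambda>x. \<Sum>a\<in>A. t (c a) (F a x))"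
proof -
  interpret T: vector_space t by (rule assms(1))
  show ?thesis
    using assms(2)
    by (auto simp: linear_on_def T.scale_right_distrib T.scale_sum_right sum.distrib
        T.scale_left_commute intro!: sum.cong)
qed

lemma multilinear_on_combination:
  assumes "vector_space t" "\<And>a. a \<in> A \<Longrightarrow> multilinear_on n s V t UNIV (F a)"
  shows "multilinear_on n s V t UNIV (\<lambda>x. \<Sum>a\<in>A. t (c a) (F a x))"
  using assms(2) unfolding multilinear_on_def by (auto intro!: linear_on_combination assms(1))

lemma tensor_power_explicit:
  fixes s :: "'f::field \<Rightarrow> 'a::ab_group_add \<Rightarrow> 'a"
  assumes "T \<in> tensor_power n s V"
  obtains A c where "A \<subseteq> pure_tensor n s V ` tuples n V" "T = (\<lambda>\<phi>. \<Sum>a\<in>A. c a * a \<phi>)"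
proof -
  interpret P: vector_space "fscale :: 'f \<Rightarrow> (('a list \<Rightarrow> 'f) \<Rightarrow> 'f) \<Rightarrow> _"
    by (rule vector_space_fscale)
  from assms obtain A c where "finite A" "A \<subseteq> pure_tensor n s V ` tuples n V"
      "T = (\<Sum>a\<in>A. fscale (c a) a)"
    unfolding tensor_power_def P.span_explicit by auto
  then show thesis
    by (intro that[of A c]) (auto simp: fun_eq_iff sum_fun_apply fscale_def)
qed

lemma multilinear_on_pairing_form:
  assumes "T \<in> tensor_power n s V"
  shows "multilinear_on n fscale (dual_space s V) (*) UNIV
           (\<lambda>\<xi>s. T (\<lambda>xs. \<Prod>i<n. (\<xi>s ! i) (xs ! i)))"
proof -
  obtain A c where A: "A \<subseteq> pure_tensor n s V ` tuples n V" "T = (\<lambda>\<phi>. \<Sum>a\<in>A. c a * a \<phi>)"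
    using assms by (rule tensor_power_explicit)
  have closed: "(\<lambda>x. \<xi> x + \<eta> x) \<in> dual_space s V" "fscale c \<xi> \<in> dual_space s V"
    if "\<xi> \<in> dual_space s V" "\<eta> \<in> dual_space s V" for \<xi> \<eta> c
    using that by (auto simp: dual_space_def linear_on_def fscale_def algebra_simps)
  have "multilinear_on n fscale (dual_space s V) (*) UNIV
          (\<lambda>\<xi>s. a (\<lambda>xs. \<Prod>i<n. (\<xi>s ! i) (xs ! i)))" if aA: "a \<in> A" for a
  proof -
    obtain xs where xs: "xs \<in> tuples n V" "a = pure_tensor n s V xs" using aA A(1) by auto
    have g: "a (\<lambda>xs. \<Prod>i<n. (\<eta>s ! i) (xs ! i)) = (\<Prod>i<n. (\<eta>s ! i) (xs ! i))"
      if "\<eta>s \<in> tuples n (dual_space s V)" for \<eta>s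
      using multilinear_on_prod_functionals[OF that] xs by (simp add: pure_tensor_def)
    show ?thesis
      unfolding multilinear_on_def
    proof (intro ballI allI impI)
      fix \<eta>s i assume \<eta>s: "\<eta>s \<in> tuples n (dual_space s V)" and i: "i < n"
      have "linear_on fscale (dual_space s V) (*) UNIV (\<lambda>\<xi>. \<Prod>k<n. (\<eta>s[i := \<xi>] ! k) (xs ! k))"
        using multilinear_on_prod_arguments[OF xs(1)] \<eta>s i by (auto simp: multilinear_on_def)
      then show "linear_on fscale (dual_space s V) (*) UNIV
          (\<lambda>\<xi>. a (\<lambda>xs. \<Prod>k<n. (\<eta>s[i := \<xi>] ! k) (xs ! k)))"
        using closed unfolding linear_on_def
        by (auto simp: g tuples_update[OF \<eta>s] plus_fun_def)
    qed
  qed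
  then show ?thesis
    unfolding A(2) by (intro multilinear_on_combination vector_space_times)
qed

lemma linear_on_pairing:
  fixes s :: "'f::field \<Rightarrow> 'a::ab_group_add \<Rightarrow> 'a"
  assumes "S \<in> tensor_power n fscale (dual_space s V)"
  shows "linear_on fscale (tensor_power n s V) (*) UNIV (pairing n S)"
proof -
  obtain A c where A: "A \<subseteq> pure_tensor n fscale (dual_space s V) ` tuples n (dual_space s V)"
      "S = (\<lambda>\<phi>. \<Sum>a\<in>A. c a * a \<phi>)"
    using assms by (rule tensor_power_explicit)
  interpret P: vector_space "fscale :: 'f \<Rightarrow> (('a list \<Rightarrow> 'f) \<Rightarrow> 'f) \<Rightarrow> _"
    by (rule vector_space_fscale)
  have closed: "T + T' \<in> tensor_power n s V" "fscale c T \<in> tensor_power n s V"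
    if "T \<in> tensor_power n s V" "T' \<in> tensor_power n s V" for T T' c
    using that by (auto simp: tensor_power_def intro: P.span_scale simp del: plus_fun_apply)
       (metis P.span_add plus_fun_def)
  have "linear_on fscale (tensor_power n s V) (*) UNIV
          (\<lambda>T. a (\<lambda>\<xi>s. T (\<lambda>xs. \<Prod>i<n. (\<xi>s ! i) (xs ! i))))" if aA: "a \<in> A" for a
  proof -
    obtain \<xi>s where \<xi>s: "a = pure_tensor n fscale (dual_space s V) \<xi>s" using aA A(1) by auto
    have a: "a (\<lambda>\<xi>s. T (\<lambda>xs. \<Prod>i<n. (\<xi>s ! i) (xs ! i))) = T (\<lambda>xs. \<Prod>i<n. (\<xi>s ! i) (xs ! i))"
      if "T \<in> tensor_power n s V" for T
      using multilinear_on_pairing_form[OF that] by (simp add: \<xi>s pure_tensor_def)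
    show ?thesis
      unfolding linear_on_def
    proof (intro conjI ballI allI)
      fix T T' c assume T: "T \<in> tensor_power n s V"
      show "a (\<lambda>\<xi>s. fscale c T (\<lambda>xs. \<Prod>i<n. (\<xi>s ! i) (xs ! i))) =
            c * a (\<lambda>\<xi>s. T (\<lambda>xs. \<Prod>i<n. (\<xi>s ! i) (xs ! i)))"
        by (simp only: a T closed(2)[OF T T]) (simp add: fscale_def)
      assume T': "T' \<in> tensor_power n s V"
      show "a (\<lambda>\<xi>s. (T + T') (\<lambda>xs. \<Prod>i<n. (\<xi>s ! i) (xs ! i))) =
            a (\<lambda>\<xi>s. T (\<lambda>xs. \<Prod>i<n. (\<xi>s ! i) (xs ! i))) +
            a (\<lambda>\<xi>s. T' (\<lambda>xs. \<Prod>i<n. (\<xi>s ! i) (xs ! i)))"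
        by (simp only: a T T' closed(1)[OF T T']) simp
    qed simp
  qed
  then show ?thesis
    unfolding A(2) pairing_def by (intro linear_on_combination vector_space_times)
qed

lemma tensor_dual_bij:
  fixes s :: "'f::field \<Rightarrow> 'a::ab_group_add \<Rightarrow> 'a"
  assumes s: "vector_space s" and fin: "finite B0" and V0: "V = module.span s B0" and n: "0 < n"
  shows "bij_betw (tensor_dual n s V) (tensor_power n fscale (dual_space s V))
           (dual_space fscale (tensor_power n s V))"
proof -
  let ?D = "dual_space s V"
  let ?pt = "pure_tensor n s V" and ?pd = "pure_tensor n fscale ?D"
  let ?T = "tensor_power n s V" and ?TD = "tensor_power n fscale ?D"
  interpret S: vector_space s by (rule s)
  interpret FD: vector_space "fscale :: 'f \<Rightarrow> ('a \<Rightarrow> 'f) \<Rightarrow> _" by (rule vector_space_fscale)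
  interpret P: vector_space "fscale :: 'f \<Rightarrow> (('a list \<Rightarrow> 'f) \<Rightarrow> 'f) \<Rightarrow> _" by (rule vector_space_fscale)
  interpret PD: vector_space "fscale :: 'f \<Rightarrow> ((('a \<Rightarrow> 'f) list \<Rightarrow> 'f) \<Rightarrow> 'f) \<Rightarrow> _"
    by (rule vector_space_fscale)
  note K = vector_space_times
  obtain B where B: "B \<subseteq> B0" "S.independent B" "B0 \<subseteq> S.span B"
    by (rule S.maximal_independent_subset)
  have finB: "finite B" using B(1) fin by (rule finite_subset)
  have V: "V = S.span B"
    unfolding V0 using S.span_mono[OF B(1)] S.span_minimal[OF B(3)] by auto
  have BV: "B \<subseteq> V" unfolding V by (rule S.span_superset)
  define dl where "dl b = (\<lambda>x. if x \<in> V then S.representation B x b else 0)" for b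
  have dl: "dl b \<in> ?D" for b
    using S.span_add[of _ B] S.span_scale[of _ B] B(2)
    by (auto simp: dual_space_def linear_on_def dl_def V S.representation_add S.representation_scale)
  have kron: "dl b b' = (if b = b' then 1 else 0)" if "b' \<in> B" for b b'
    using that BV B(2) by (auto simp: dl_def S.representation_basis)
  have dual_expand: "\<xi> = (\<Sum>b\<in>B. fscale (\<xi> b) (dl b))" if "\<xi> \<in> ?D" for \<xi>
  proof
    fix x
    have lin: "linear_on s V (*) UNIV \<xi>" and out: "x \<notin> V \<Longrightarrow> \<xi> x = 0"
      using that by (auto simp: dual_space_def)
    show "\<xi> x = (\<Sum>b\<in>B. fscale (\<xi> b) (dl b)) x"
    proof (cases "x \<in> V")
      case True
      have "\<xi> (\<Sum>b\<in>A. s (c b) b) = (\<Sum>b\<in>A. c b * \<xi> b)" if "A \<subseteq> B" "finite A" for A c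
        using that(2,1)
      proof (induction A)
        case empty
        have "\<xi> (s 0 x) = 0 * \<xi> x" using lin True unfolding linear_on_def by blast
        then show ?case by simp
      next
        case (insert b A)
        have bV: "x \<in> V" if "x \<in> insert b A" for x using insert.prems BV that by auto
        then have "(\<Sum>b\<in>A. s (c b) b) \<in> V"
          unfolding V by (intro S.span_sum S.span_scale) auto
        moreover have "s (c b) b \<in> V" "b \<in> V"
          using bV[of b] unfolding V by (auto intro: S.span_scale)
        ultimately have "\<xi> (s (c b) b + (\<Sum>b\<in>A. s (c b) b)) = c b * \<xi> b + (\<Sum>b\<in>A. c b * \<xi> b)"
          using lin insert by (auto simp: linear_on_def)
        then show ?case using insert by simp
      qed
      from this[OF subset_refl finB, of "S.representation B x"]
      have "\<xi> x = (\<Sum>b\<in>B. S.representation B x b * \<xi> b)"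
        using S.sum_representation_eq[OF B(2) _ finB, of x] True V by simp
      with True show ?thesis
        by (simp add: sum_fun_apply fscale_def dl_def mult.commute)
    qed (simp add: out sum_fun_apply fscale_def dl_def)
  qed
  have dual_span: "?D = FD.span (dl ` B)"
  proof
    show "?D \<subseteq> FD.span (dl ` B)"
    proof
      fix \<xi> assume "\<xi> \<in> ?D"
      then show "\<xi> \<in> FD.span (dl ` B)"
        by (subst dual_expand) (assumption, intro FD.span_sum FD.span_scale FD.span_base imageI)
    qed
    have "FD.subspace ?D"
      by (auto simp: FD.subspace_def dual_space_def linear_on_def fscale_def algebra_simps)
    then show "FD.span (dl ` B) \<subseteq> ?D" using dl by (intro FD.span_minimal) auto
  qed
  have map_dl: "map dl bs \<in> tuples n ?D" if "bs \<in> tuples n B" for bs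
    using that dl by (auto simp: tuples_def)
  have TB: "finite (tuples n B)"
    using finite_lists_length_eq[OF finB, of n] by (simp add: tuples_def conj_commute)
  have kron_tuple: "(\<Prod>i<n. dl (bs ! i) (cs ! i)) = (if bs = cs then 1 else 0)"
    if "bs \<in> tuples n B" "cs \<in> tuples n B" for bs cs
  proof -
    have "(\<Prod>i<n. dl (bs ! i) (cs ! i)) = (\<Prod>i<n. if bs ! i = cs ! i then 1 else 0)"
      using that by (intro prod.cong refl kron) (auto simp: tuples_def)
    also have "\<dots> = (if \<forall>i<n. bs ! i = cs ! i then 1 else 0)"
      by auto
    also have "(\<forall>i<n. bs ! i = cs ! i) \<longleftrightarrow> bs = cs"
      using that by (auto simp: tuples_def intro: nth_equalityI)
    finally show ?thesis .
  qed
  have TBV: "tuples n B \<subseteq> tuples n V" using BV by (auto simp: tuples_def)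
  have pt_in: "?pt xs \<in> ?T" if "xs \<in> tuples n V" for xs
    using that by (auto simp: tensor_power_def intro: P.span_base)
  have pd_in: "?pd xs \<in> ?TD" if "xs \<in> tuples n ?D" for xs
    using that by (auto simp: tensor_power_def intro: PD.span_base)

  have into: "tensor_dual n s V S \<in> dual_space fscale ?T" if "S \<in> ?TD" for S
  proof -
    have "x + y \<in> ?T" "fscale c x \<in> ?T" if "x \<in> ?T" "y \<in> ?T" for x y c
      using that P.span_add P.span_scale unfolding tensor_power_def by metis+
    then show ?thesis
      using linear_on_pairing[OF that]
      by (simp add: dual_space_def linear_on_def tensor_dual_def del: plus_fun_apply)
  qed

  have expand: "S = (\<Sum>bs\<in>tuples n B. fscale (pairing n S (?pt bs)) (?pd (map dl bs)))"
    if "S \<in> ?TD" for S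
  proof -
    define G where "G S = (\<Sum>bs\<in>tuples n B. fscale (pairing n S (?pt bs)) (?pd (map dl bs)))" for S
    have "linear_on fscale ?TD fscale UNIV (\<lambda>S. S)" by (simp add: linear_on_def)
    moreover have "linear_on fscale ?TD fscale UNIV G"
      by (simp add: linear_on_def G_def pairing_def fun_eq_iff sum_fun_apply fscale_def
          sum.distrib sum_distrib_left algebra_simps)
    moreover have "\<forall>\<xi>s\<in>tuples n ?D. ?pd \<xi>s = G (?pd \<xi>s)"
    proof
      let ?R = "\<lambda>\<xi>s. \<lambda>\<phi>. \<Sum>bs\<in>tuples n B. ?pd (map dl bs) \<phi> * (\<Prod>i<n. (\<xi>s ! i) (bs ! i))"
      fix \<xi>s assume \<xi>s: "\<xi>s \<in> tuples n ?D"
      have "?pd \<xi>s \<phi> = ?R \<xi>s \<phi>" for \<phi>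
      proof (rule multilinear_on_eqI[OF vector_space_fscale K dual_span _ _ _ \<xi>s])
        show "multilinear_on n fscale ?D (*) UNIV (\<lambda>\<xi>s. ?pd \<xi>s \<phi>)"
        proof (rule multilinear_on_comp_linear[OF multilinear_pure_tensor])
          show "linear_on fscale ?TD (*) UNIV (\<lambda>T. T \<phi>)" by (simp add: linear_on_def fscale_def)
        qed
        show "multilinear_on n fscale ?D (*) UNIV (\<lambda>\<xi>s. ?R \<xi>s \<phi>)"
          using TBV by (intro multilinear_on_combination K multilinear_on_prod_arguments) auto
        fix \<eta>s assume "\<eta>s \<in> tuples n (dl ` B)"
        then have "\<eta>s \<in> map dl ` lists B" "length \<eta>s = n"
          unfolding lists_image[symmetric] by (auto simp: tuples_def)
        then obtain cs where "\<eta>s = map dl cs" "cs \<in> lists B" "length \<eta>s = n"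
          by blast
        then have cs: "cs \<in> tuples n B" "\<eta>s = map dl cs"
          by (auto simp: tuples_def)
        have "?R \<eta>s \<phi> = (\<Sum>bs\<in>tuples n B. ?pd (map dl bs) \<phi> * (if cs = bs then 1 else 0))"
        proof (rule sum.cong)
          fix bs assume bs: "bs \<in> tuples n B"
          have "(\<Prod>i<n. (\<eta>s ! i) (bs ! i)) = (\<Prod>i<n. dl (cs ! i) (bs ! i))"
            using cs by (intro prod.cong) (auto simp: tuples_def)
          then show "?pd (map dl bs) \<phi> * (\<Prod>i<n. (\<eta>s ! i) (bs ! i)) =
              ?pd (map dl bs) \<phi> * (if cs = bs then 1 else 0)"
            using kron_tuple[OF cs(1) bs] by simp
        qed simp
        also have "\<dots> = ?pd (map dl cs) \<phi>"
          using cs(1) TB by (simp add: if_distrib[of "\<lambda>x. _ * x"] cong: if_cong)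
        finally show "?pd \<eta>s \<phi> = ?R \<eta>s \<phi>" by (simp add: cs(2))
      qed
      moreover have "?R \<xi>s = G (?pd \<xi>s)"
        unfolding G_def using TBV \<xi>s
        by (auto simp: fun_eq_iff sum_fun_apply fscale_apply pairing_pure mult.commute intro!: sum.cong)
      ultimately show "?pd \<xi>s = G (?pd \<xi>s)" by (simp add: fun_eq_iff)
    qed
    ultimately show ?thesis
      using tensor_power_linear_eqI[OF vector_space_fscale _ _ _ that, of UNIV "\<lambda>S. S" G]
      by (simp add: G_def)
  qed

  show ?thesis
  proof (rule bij_betw_imageI)
    show "inj_on (tensor_dual n s V) ?TD"
    proof (rule inj_onI)
      fix S S' assume S: "S \<in> ?TD" "S' \<in> ?TD" "tensor_dual n s V S = tensor_dual n s V S'"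
      have "pairing n S (?pt bs) = pairing n S' (?pt bs)" if "bs \<in> tuples n B" for bs
        using fun_cong[OF S(3), of "?pt bs"] pt_in[of bs] that TBV
        by (auto simp: tensor_dual_def)
      then show "S = S'"
        by (subst expand[OF S(1)], subst expand[OF S(2)]) (auto intro!: sum.cong)
    qed
    show "tensor_dual n s V ` ?TD = dual_space fscale ?T"
    proof (intro equalityI subsetI)
      fix \<eta> assume \<eta>: "\<eta> \<in> dual_space fscale ?T"
      then have lin: "linear_on fscale ?T (*) UNIV \<eta>" and out: "\<And>T. T \<notin> ?T \<Longrightarrow> \<eta> T = 0"
        by (auto simp: dual_space_def)
      define S where "S = (\<Sum>bs\<in>tuples n B. fscale (\<eta> (?pt bs)) (?pd (map dl bs)))"
      have S: "S \<in> ?TD"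
        unfolding S_def tensor_power_def using map_dl
        by (intro PD.span_sum PD.span_scale PD.span_base) auto
      have "pairing n S (?pt xs) = \<eta> (?pt xs)" if xs: "xs \<in> tuples n V" for xs
      proof -
        let ?R = "\<lambda>xs. \<Sum>bs\<in>tuples n B. \<eta> (?pt bs) * (\<Prod>i<n. (map dl bs ! i) (xs ! i))"
        have "pairing n S (?pt xs) = ?R xs"
          using pairing_pure[OF xs map_dl]
          by (simp add: S_def pairing_def sum_fun_apply fscale_apply)
        also have "?R xs = \<eta> (?pt xs)"
        proof (rule multilinear_on_eqI[OF s K V _ _ _ xs])
          show "multilinear_on n s V (*) UNIV ?R"
            using map_dl by (intro multilinear_on_combination K multilinear_on_prod_functionals)
          show "multilinear_on n s V (*) UNIV (\<lambda>xs. \<eta> (?pt xs))"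
            by (rule multilinear_on_comp_linear[OF multilinear_pure_tensor lin])
          fix cs assume cs: "cs \<in> tuples n B"
          have "?R cs = (\<Sum>bs\<in>tuples n B. \<eta> (?pt bs) * (if bs = cs then 1 else 0))"
          proof (rule sum.cong)
            fix bs assume bs: "bs \<in> tuples n B"
            have "(\<Prod>i<n. (map dl bs ! i) (cs ! i)) = (\<Prod>i<n. dl (bs ! i) (cs ! i))"
              using bs by (intro prod.cong) (auto simp: tuples_def)
            then show "\<eta> (?pt bs) * (\<Prod>i<n. (map dl bs ! i) (cs ! i)) =
                \<eta> (?pt bs) * (if bs = cs then 1 else 0)"
              using kron_tuple[OF bs cs] by simp
          qed simp
          also have "\<dots> = \<eta> (?pt cs)"
            using cs TB by (simp add: if_distrib[of "\<lambda>x. _ * x"] cong: if_cong)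
          finally show "?R cs = \<eta> (?pt cs)" .
        qed
        finally show ?thesis .
      qed
      then have "pairing n S T = \<eta> T" if "T \<in> ?T" for T
        using tensor_power_linear_eqI[OF K linear_on_pairing[OF S] lin _ that] by blast
      then have "tensor_dual n s V S = \<eta>" by (auto simp: tensor_dual_def fun_eq_iff out)
      with S show "\<eta> \<in> tensor_dual n s V ` ?TD" by blast
    qed (use into in auto)
  qed
qed

end

theory Submission
  imports Defs
begin

text \<open>
  The theorem says that the notion of \<open>n\<close>-Lie bialgebra is symmetric under exchanging the roles of
  \<open>(\<gg>, \<mu>, \<gamma>)\<close> and \<open>(\<gg>\<^sup>*, \<^sup>t\<gamma>, \<^sup>t\<mu>)\<close>, where \<open>\<gg>\<close> is the space \<open>V\<close>. That \<open>\<^sup>t\<gamma>\<close> is an \<open>n\<close>-Lie bracket on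
  \<open>\<gg>\<^sup>*\<close> is part of the hypothesis. The bracket that \<open>\<^sup>t\<mu>\<close> induces on \<open>\<gg>\<^sup>*\<^sup>*\<close> is \<open>\<mu>\<close> itself, carried
  over by the isomorphism that sends a vector to the evaluation at it, so it is an \<open>n\<close>-Lie
  bracket too (\<open>n_lie_algebra_bidual\<close>).

  It remains to see that the cocycle identity is self-dual. In finite dimension an element of
  \<open>(\<gg>\<^sup>*)\<^sup>\<otimes>\<^sup>n\<close> is determined by its pairings with the pure tensors \<open>x\<^sub>1 \<otimes> \<dots> \<otimes> x\<^sub>n\<close>
  (\<open>dual_tensor_eqI\<close>), so fix such \<open>x\<close> and functionals \<open>\<xi>\<^sub>1, \<dots>, \<xi>\<^sub>n\<close>. Write \<open>A\<^sub>i\<close> for the \<open>ad\<close> of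
  the \<open>x\<close>s other than \<open>x\<^sub>i\<close>, and \<open>B\<^sub>j\<close> for the \<open>ad\<close> in \<open>\<gg>\<^sup>*\<close> of the \<open>\<xi>\<close>s other than \<open>\<xi>\<^sub>j\<close>. Set
  \<open>X\<^sub>i\<^sub>j = B\<^sub>j (\<xi>\<^sub>j \<circ> A\<^sub>i) (x\<^sub>i)\<close>.
  The left-hand side of the dual identity pairs to \<open>\<langle>\<xi>\<^sub>1 \<otimes> \<dots> \<otimes> \<xi>\<^sub>n, \<gamma> (\<mu> x)\<rangle>\<close>. Expand this by the
  cocycle identity for \<open>\<gamma>\<close>, transpose the action of \<open>A\<^sub>i\<close> on the factor \<open>j\<close> to \<open>\<xi>\<^sub>j\<close>, and move the
  argument \<open>j\<close> of \<open>\<^sup>t\<gamma>\<close> to the end by skew-symmetry; the result is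
  \<open>\<Sum>\<^sub>i\<Sum>\<^sub>j (-1)\<^sup>n\<^sup>-\<^sup>i (-1)\<^sup>n\<^sup>-\<^sup>j X\<^sub>i\<^sub>j\<close> (\<open>tensor_action_form\<close>). On the right-hand side, \<open>B\<^sub>i\<close> acts on the
  factor \<open>j\<close> of \<open>\<^sup>t\<mu> \<xi>\<^sub>i\<close>. By reflexivity \<open>\<eta> \<mapsto> (B\<^sub>i \<eta>) (x\<^sub>j)\<close> is evaluation at some vector \<open>z\<close>, so the
  pairing of this term is \<open>\<xi>\<^sub>i\<close> of the bracket of the \<open>x\<close>s with \<open>x\<^sub>j\<close> replaced by \<open>z\<close>. That is
  \<open>(-1)\<^sup>n\<^sup>-\<^sup>j (\<xi>\<^sub>i \<circ> A\<^sub>j) (z) = (-1)\<^sup>n\<^sup>-\<^sup>j X\<^sub>j\<^sub>i\<close> (\<open>tensor_action_dual_form\<close>). With the sign \<open>(-1)\<^sup>n\<^sup>-\<^sup>i\<close> of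
  the \<open>i\<close>-th term in the cocycle identity, both sides are the same double sum with its indices
  exchanged.
\<close>

section \<open>Linear maps, tensors and multilinear forms\<close>

lemma linear_on_sum:
  assumes s: "vector_space s" and V: "module.subspace s V" and t: "vector_space t"
    and f: "linear_on s V t W f" and A: "finite A" "\<And>a. a \<in> A \<Longrightarrow> g a \<in> V"
  shows "f (\<Sum>a\<in>A. s (c a) (g a)) = (\<Sum>a\<in>A. t (c a) (f (g a)))"
proof -
  interpret S: vector_space s by (rule s)
  interpret T: vector_space t by (rule t)
  from A show ?thesis
  proof (induction A)
    case empty
    have "f (s 0 0) = t 0 (f 0)" using f S.subspace_0[OF V] unfolding linear_on_def by blast
    then show ?case by simp
  next
    case (insert b A)
    then have "s (c b) (g b) \<in> V" "(\<Sum>a\<in>A. s (c a) (g a)) \<in> V"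
      by (auto intro!: S.subspace_sum[OF V] S.subspace_scale[OF V])
    then show ?case using f insert by (simp add: linear_on_def)
  qed
qed

lemma dual_map_in_dual_space:
  assumes f: "linear_on s V t W f" and \<eta>: "\<eta> \<in> dual_space t W"
    and s: "vector_space s" and V: "module.subspace s V"
  shows "dual_map V f \<eta> \<in> dual_space s V"
proof -
  interpret S: vector_space s by (rule s)
  show ?thesis
    using f \<eta> S.subspace_add[OF V] S.subspace_scale[OF V]
    by (simp add: dual_map_def dual_space_def linear_on_def)
qed

lemma subspace_dual_space: "module.subspace fscale (dual_space s V)"
proof -
  interpret vector_space "fscale :: 'a \<Rightarrow> ('b \<Rightarrow> 'a) \<Rightarrow> _" by (rule vector_space_fscale)
  show ?thesis
    by (auto simp: subspace_def dual_space_def linear_on_def fscale_def algebra_simps)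
qed

lemma multilinear_on_cong:
  assumes s: "vector_space s" and V: "module.subspace s V"
    and eq: "\<And>xs. xs \<in> tuples n V \<Longrightarrow> f xs = g xs"
    and f: "multilinear_on n s V t W f"
  shows "multilinear_on n s V t W g"
  unfolding multilinear_on_def
proof (intro ballI allI impI)
  interpret vector_space s by (rule s)
  fix xs i assume xs: "xs \<in> tuples n V" and i: "i < n"
  then have "linear_on s V t W (\<lambda>x. f (xs[i := x]))" using f by (simp add: multilinear_on_def)
  then show "linear_on s V t W (\<lambda>x. g (xs[i := x]))"
    using eq[OF tuples_update[OF xs]] subspace_add[OF V] subspace_scale[OF V]
    by (simp add: linear_on_def)
qed

text \<open>
  Pure tensors evaluate a multilinear form at a tuple over \<open>V\<close> and discard any other function, so
  their combinations cannot distinguish functions that agree on such tuples. This justifies rewriting a form under a tensor by identities that hold only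
  for vectors of \<open>V\<close> or functionals in its dual.
\<close>

lemma tensor_power_cong:
  assumes s: "vector_space s" and V: "module.subspace s V"
    and T: "T \<in> tensor_power n s V"
    and eq: "\<And>xs. xs \<in> tuples n V \<Longrightarrow> \<phi> xs = \<psi> xs"
  shows "T \<phi> = T \<psi>"
proof -
  obtain A c where A: "A \<subseteq> pure_tensor n s V ` tuples n V" "T = (\<lambda>\<phi>. \<Sum>a\<in>A. c a * a \<phi>)"
    using T by (rule tensor_power_explicit)
  have "multilinear_on n s V (*) UNIV \<phi> \<longleftrightarrow> multilinear_on n s V (*) UNIV \<psi>"
    using multilinear_on_cong[OF s V] eq by metis
  then have "a \<phi> = a \<psi>" if "a \<in> A" for a
    using A(1) that eq by (auto simp: pure_tensor_def)
  then show ?thesis unfolding A(2) by (intro sum.cong refl arg_cong2[where f = "(*)"])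
qed

lemma tensor_action_in_tensor_power:
  fixes s :: "'f::field \<Rightarrow> 'a::ab_group_add \<Rightarrow> 'a"
  assumes D: "linear_on s V s V D" and T: "T \<in> tensor_power n s V"
  shows "tensor_action n s V D T \<in> tensor_power n s V"
proof -
  interpret P: vector_space "fscale :: 'f \<Rightarrow> (('a list \<Rightarrow> 'f) \<Rightarrow> 'f) \<Rightarrow> _"
    by (rule vector_space_fscale)
  obtain A c where A: "A \<subseteq> pure_tensor n s V ` tuples n V" "T = (\<lambda>\<phi>. \<Sum>a\<in>A. c a * a \<phi>)"
    using T by (rule tensor_power_explicit)
  have "tensor_action n s V D T = (\<Sum>a\<in>A. fscale (c a) (tensor_action n s V D a))"
  proof
    fix \<phi>
    show "tensor_action n s V D T \<phi> = (\<Sum>a\<in>A. fscale (c a) (tensor_action n s V D a)) \<phi>"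
      by (simp add: tensor_action_def A(2) sum_fun_apply fscale_apply sum_distrib_left)
         (auto intro: sum.swap)
  qed
  moreover have "tensor_action n s V D a \<in> tensor_power n s V" if aA: "a \<in> A" for a
  proof -
    obtain ys where ys: "ys \<in> tuples n V" "a = pure_tensor n s V ys" using aA A(1) by auto
    have "ys[j := D (ys ! j)] \<in> tuples n V" if "j < n" for j
    proof (rule tuples_update[OF ys(1)])
      have "ys ! j \<in> V" using ys(1) that by (auto simp: tuples_def)
      then show "D (ys ! j) \<in> V" using D by (simp add: linear_on_def)
    qed
    then show ?thesis
      unfolding ys(2) tensor_action_pure[OF D] tensor_power_def
      by (intro P.span_sum P.span_base imageI) simp
  qed
  ultimately show ?thesis
    unfolding tensor_power_def by (simp add: P.span_sum P.span_scale)
qed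

lemma pairing_pure_tensor_right:
  fixes s :: "'f::field \<Rightarrow> 'a::ab_group_add \<Rightarrow> 'a"
  assumes "S \<in> tensor_power n fscale (dual_space s V)"
  shows "pairing n S (pure_tensor n s V xs) = S (\<lambda>\<xi>s. \<Prod>i<n. (\<xi>s ! i) (xs ! i))"
  unfolding pairing_def
proof (rule tensor_power_cong[OF vector_space_fscale subspace_dual_space assms])
  fix \<xi>s assume "\<xi>s \<in> tuples n (dual_space s V)"
  then show "pure_tensor n s V xs (\<lambda>xs. \<Prod>i<n. (\<xi>s ! i) (xs ! i)) = (\<Prod>i<n. (\<xi>s ! i) (xs ! i))"
    by (simp add: pure_tensor_def multilinear_on_prod_functionals)
qed

lemma pairing_pure_tensor_left:
  assumes "T \<in> tensor_power n s V"
  shows "pairing n (pure_tensor n fscale (dual_space s V) \<xi>s) T = T (\<lambda>xs. \<Prod>i<n. (\<xi>s ! i) (xs ! i))"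
  using multilinear_on_pairing_form[OF assms] by (simp add: pairing_def pure_tensor_def)

text \<open>
  This is injectivity of \<open>(V\<^sup>*)\<^sup>\<otimes>\<^sup>n \<rightarrow> (V\<^sup>\<otimes>\<^sup>n)\<^sup>*\<close>, tested on the pure tensors, which span \<open>V\<^sup>\<otimes>\<^sup>n\<close>.
\<close>

lemma dual_tensor_eqI:
  fixes s :: "'f::field \<Rightarrow> 'a::ab_group_add \<Rightarrow> 'a"
  assumes s: "vector_space s" and fin: "finite B" "V = module.span s B" and n: "0 < n"
    and S: "S \<in> tensor_power n fscale (dual_space s V)" "S' \<in> tensor_power n fscale (dual_space s V)"
    and eq: "\<And>xs. xs \<in> tuples n V \<Longrightarrow>
      S (\<lambda>\<xi>s. \<Prod>i<n. (\<xi>s ! i) (xs ! i)) = S' (\<lambda>\<xi>s. \<Prod>i<n. (\<xi>s ! i) (xs ! i))"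
  shows "S = S'"
proof -
  have "pairing n S T = pairing n S' T" if "T \<in> tensor_power n s V" for T
    by (rule tensor_power_linear_eqI[OF vector_space_times linear_on_pairing[OF S(1)]
          linear_on_pairing[OF S(2)] _ that])
       (simp add: pairing_pure_tensor_right S eq)
  then have "tensor_dual n s V S = tensor_dual n s V S'"
    by (simp add: tensor_dual_def fun_eq_iff)
  then show ?thesis
    using tensor_dual_bij[OF s fin n] S by (auto simp: bij_betw_def dest: inj_onD)
qed

section \<open>The bidual\<close>

text \<open>
  Reflexivity: in terms of a basis \<open>b\<close> of \<open>V\<close> with dual basis \<open>b\<^sup>*\<close>, the vector representing \<open>\<Phi>\<close> is
  \<open>\<Sum>\<^sub>b \<Phi> (b\<^sup>*) b\<close>.
\<close>

lemma bidual_is_evaluation: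
  fixes s :: "'f::field \<Rightarrow> 'a::ab_group_add \<Rightarrow> 'a"
  assumes s: "vector_space s" and fin: "finite B0" "V = module.span s B0"
    and \<Phi>: "linear_on fscale (dual_space s V) (*) UNIV \<Phi>"
  obtains z where "z \<in> V" "\<And>\<xi>. \<xi> \<in> dual_space s V \<Longrightarrow> \<Phi> \<xi> = \<xi> z"
proof -
  interpret S: vector_space s by (rule s)
  obtain B where B: "B \<subseteq> B0" "S.independent B" "B0 \<subseteq> S.span B"
    by (rule S.maximal_independent_subset)
  have finB: "finite B" using B(1) fin(1) by (rule finite_subset)
  have V: "V = S.span B"
    unfolding fin(2) using S.span_mono[OF B(1)] S.span_minimal[OF B(3)] by auto
  have BV: "B \<subseteq> V" unfolding V by (rule S.span_superset)
  have sub: "S.subspace V" unfolding V by (rule S.subspace_span)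
  \<comment> \<open>the dual basis, extended by 0 outside \<open>V\<close>\<close>
  define dl where "dl b = dual_map V (\<lambda>x. S.representation B x b) (\<lambda>c. c)" for b
  have dl: "dl b \<in> dual_space s V" for b
    using S.span_add[of _ B] S.span_scale[of _ B] B(2)
    by (auto simp: dual_space_def linear_on_def dl_def dual_map_def V
        S.representation_add S.representation_scale)
  define z where "z = (\<Sum>b\<in>B. s (\<Phi> (dl b)) b)"
  have "z \<in> V" unfolding z_def V by (intro S.span_sum S.span_scale S.span_base)
  moreover have "\<Phi> \<xi> = \<xi> z" if \<xi>: "\<xi> \<in> dual_space s V" for \<xi>
  proof -
    have lin: "linear_on s V (*) UNIV \<xi>" and out: "\<And>x. x \<notin> V \<Longrightarrow> \<xi> x = 0"
      using \<xi> by (auto simp: dual_space_def)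
    note lin_sum = linear_on_sum[OF s sub vector_space_times lin finB, of "\<lambda>b. b"]
    have "\<xi> = (\<Sum>b\<in>B. fscale (\<xi> b) (dl b))"
    proof
      fix x
      show "\<xi> x = (\<Sum>b\<in>B. fscale (\<xi> b) (dl b)) x"
      proof (cases "x \<in> V")
        case True
        have "\<xi> x = \<xi> (\<Sum>b\<in>B. s (S.representation B x b) b)"
          using S.sum_representation_eq[OF B(2) _ finB, of x] True V by simp
        also have "\<dots> = (\<Sum>b\<in>B. S.representation B x b * \<xi> b)"
          using BV by (intro lin_sum) auto
        finally show ?thesis
          using True by (simp add: sum_fun_apply fscale_apply dl_def dual_map_def mult.commute)
      qed (simp add: out sum_fun_apply fscale_apply dl_def dual_map_def)
    qed
    then have "\<Phi> \<xi> = \<Phi> (\<Sum>b\<in>B. fscale (\<xi> b) (dl b))" by simp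
    also have "\<dots> = (\<Sum>b\<in>B. \<xi> b * \<Phi> (dl b))"
      by (intro linear_on_sum[OF vector_space_fscale subspace_dual_space vector_space_times \<Phi> finB] dl)
    also have "\<dots> = \<xi> z"
      unfolding z_def using BV by (subst lin_sum) (auto simp: mult.commute)
    finally show ?thesis .
  qed
  ultimately show thesis by (rule that)
qed

section \<open>Brackets with one argument singled out\<close>

text \<open>
  The argument travels to the end through \<open>length vs\<close> adjacent transpositions.
\<close>

lemma n_lie_algebra_move_to_end:
  assumes L: "n_lie_algebra n s V br" and "us @ y # vs \<in> tuples n V"
  shows "br (us @ y # vs) = s ((-1) ^ length vs) (br (us @ vs @ [y]))"
proof -
  interpret S: vector_space s using L by (simp add: n_lie_algebra_def)
  show ?thesis
    using assms(2)
  proof (induction vs arbitrary: us)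
    case Nil
    show ?case by simp
  next
    case (Cons v vs)
    let ?xs = "us @ y # v # vs" and ?k = "length us"
    let ?p = "Transposition.transpose ?k (Suc ?k)"
    have n: "Suc ?k < n" "length ?xs = n" using Cons.prems by (auto simp: tuples_def)
    have p: "?p permutes {..<n}" using n by (intro permutes_swap_id) auto
    have "permute_list ?p ?xs = us @ v # y # vs"
    proof (rule nth_equalityI)
      fix i assume "i < length (permute_list ?p ?xs)"
      then have i: "i < length ?xs" by simp
      have "permute_list ?p ?xs ! i = ?xs ! ?p i"
        using p i n by (intro permute_list_nth) simp
      also have "\<dots> = (us @ v # y # vs) ! i"
        by (auto simp: Transposition.transpose_def nth_append nth_Cons split: nat.split)
      finally show "permute_list ?p ?xs ! i = (us @ v # y # vs) ! i" .
    qed simp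
    moreover have "sign ?p = -1" by (simp add: sign_swap_id)
    moreover have "br (permute_list ?p ?xs) = s (of_int (sign ?p)) (br ?xs)"
      using L Cons.prems p unfolding n_lie_algebra_def by blast
    ultimately have "br (us @ v # y # vs) = - br ?xs"
      by simp
    moreover have "br ((us @ [v]) @ y # vs) = s ((-1) ^ length vs) (br ((us @ [v]) @ vs @ [y]))"
      using Cons.prems by (intro Cons.IH) (auto simp: tuples_def)
    ultimately show ?case by (simp add: minus_equation_iff[of "br _"])
  qed
qed

text \<open>
  The operator in the \<open>i\<close>-th term of the cocycle condition. Up to sign it is the bracket as a
  function of its \<open>i\<close>-th argument, by the lemma that follows.
\<close>

definition ad_omit :: "('a list \<Rightarrow> 'a) \<Rightarrow> nat \<Rightarrow> 'a list \<Rightarrow> 'a \<Rightarrow> 'a" where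
  "ad_omit br i xs = (\<lambda>y. br (take i xs @ drop (Suc i) xs @ [y]))"

lemma n_lie_algebra_update:
  assumes L: "n_lie_algebra n s V br" and xs: "xs \<in> tuples n V" and "y \<in> V" and i: "i < n"
  shows "br (xs[i := y]) = s ((-1) ^ (n - Suc i)) (ad_omit br i xs y)"
proof -
  have len: "length xs = n" using xs by (simp add: tuples_def)
  have eq: "xs[i := y] = take i xs @ y # drop (Suc i) xs"
    using i len by (simp add: upd_conv_take_nth_drop)
  show ?thesis
    using n_lie_algebra_move_to_end[OF L, of "take i xs" y "drop (Suc i) xs"]
      tuples_update[OF xs \<open>y \<in> V\<close>, of i] len
    by (simp add: eq ad_omit_def)
qed

lemma linear_on_ad_omit:
  assumes L: "n_lie_algebra n s V br" and xs: "xs \<in> tuples n V" and i: "i < n"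
  shows "linear_on s V s V (ad_omit br i xs)"
proof -
  interpret S: vector_space s using L by (simp add: n_lie_algebra_def)
  have "0 \<in> V" using L S.subspace_0 by (simp add: n_lie_algebra_def)
  define us where "us = take i xs @ drop (Suc i) xs"
  have us: "length us = n - 1" "set us \<subseteq> V"
    using xs i by (auto simp: us_def tuples_def dest: in_set_takeD in_set_dropD)
  have "us @ [0] \<in> tuples n V"
    using us i \<open>0 \<in> V\<close> by (auto simp: tuples_def)
  then have "linear_on s V s V (\<lambda>y. br ((us @ [0])[n - 1 := y]))"
    using L i by (simp add: n_lie_algebra_def multilinear_on_def)
  moreover have "(us @ [0])[n - 1 := y] = us @ [y]" for y
    unfolding us(1)[symmetric] by simp
  ultimately show ?thesis by (simp add: ad_omit_def us_def)
qed

section \<open>Homomorphic images\<close>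

lemma tuples_image: "tuples n (f ` V) = map f ` tuples n V"
proof (intro equalityI subsetI)
  fix X assume X: "X \<in> tuples n (f ` V)"
  have "X = map f (map (inv_into V f) X)"
    using X by (auto simp: tuples_def f_inv_into_f intro!: map_idI[symmetric])
  moreover have "map (inv_into V f) X \<in> tuples n V"
    using X by (auto simp: tuples_def intro!: inv_into_into)
  ultimately show "X \<in> map f ` tuples n V" by blast
qed (force simp: tuples_def)

text \<open>
  All the axioms are identities between expressions in the bracket, so they pass along a
  surjective homomorphism \<open>f\<close>.
\<close>

lemma n_lie_algebra_image:
  assumes L: "n_lie_algebra n s V br" and n: "0 < n"
    and t: "vector_space t" and f: "linear_on s V t W f" and W: "W = f ` V"
    and br': "\<And>xs. xs \<in> tuples n V \<Longrightarrow> br' (map f xs) = f (br xs)"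
  shows "n_lie_algebra n t W br'"
proof -
  interpret S: vector_space s using L by (simp add: n_lie_algebra_def)
  interpret T: vector_space t by (rule t)
  have V: "S.subspace V" and m: "multilinear_on n s V s V br"
    and skew: "\<And>xs p. xs \<in> tuples n V \<Longrightarrow> p permutes {..<n} \<Longrightarrow>
        br (permute_list p xs) = s (of_int (sign p)) (br xs)"
    and jac: "\<And>xs ys. xs \<in> tuples (n - 1) V \<Longrightarrow> ys \<in> tuples n V \<Longrightarrow>
        br (xs @ [br ys]) = (\<Sum>i<n. br (ys[i := br (xs @ [ys ! i])]))"
    using L by (simp_all add: n_lie_algebra_def)
  have fadd: "f (x + y) = f x + f y" if "x \<in> V" "y \<in> V" for x y
    using f that by (simp add: linear_on_def)
  have fscl: "f (s c x) = t c (f x)" if "x \<in> V" for x c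
    using f that by (simp add: linear_on_def)
  have fsum: "f (\<Sum>a\<in>A. g a) = (\<Sum>a\<in>A. f (g a))" if "finite A" "\<And>a. a \<in> A \<Longrightarrow> g a \<in> V"
    for g and A :: "nat set"
    using linear_on_sum[OF S.vector_space_axioms V t f that, where c = "\<lambda>_. 1"] by simp
  have brV: "br xs \<in> V" if "xs \<in> tuples n V" for xs
    using multilinear_on_mem[OF m that n] .
  show ?thesis
    unfolding n_lie_algebra_def
  proof (intro conjI ballI allI impI)
    show "vector_space t" by (rule t)
    show "T.subspace W"
      unfolding W
    proof (rule T.subspaceI)
      have "f 0 = 0" using fscl[OF S.subspace_0[OF V], of 0] by simp
      then show "0 \<in> f ` V" using S.subspace_0[OF V] by (metis imageI)
    next
      fix x y assume "x \<in> f ` V" "y \<in> f ` V"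
      then show "x + y \<in> f ` V" by (auto simp: fadd[symmetric] intro!: imageI S.subspace_add[OF V])
    next
      fix c x assume "x \<in> f ` V"
      then show "t c x \<in> f ` V" by (auto simp: fscl[symmetric] intro!: imageI S.subspace_scale[OF V])
    qed
    show "multilinear_on n t W t W br'"
      unfolding multilinear_on_def
    proof (intro ballI allI impI)
      fix X i assume "X \<in> tuples n W" and i: "i < n"
      then obtain xs where xs: "xs \<in> tuples n V" "X = map f xs" unfolding W tuples_image by auto
      have lin: "linear_on s V s V (\<lambda>x. br (xs[i := x]))"
        using m xs i by (simp add: multilinear_on_def)
      have eq: "br' (X[i := f x]) = f (br (xs[i := x]))" if "x \<in> V" for x
        using br'[OF tuples_update[OF xs(1) that]] by (simp add: xs(2) map_update)
      show "linear_on t W t W (\<lambda>x. br' (X[i := x]))"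
        unfolding linear_on_def W
      proof (intro conjI ballI allI; (elim imageE)?; hypsubst?)
        fix x assume x: "x \<in> V"
        show "br' (X[i := f x]) \<in> f ` V" using x lin by (simp add: eq linear_on_def)
        show "br' (X[i := t c (f x)]) = t c (br' (X[i := f x]))" for c
          using x lin S.subspace_scale[OF V] by (simp add: fscl[symmetric] eq linear_on_def)
        fix y assume y: "y \<in> V"
        show "br' (X[i := f x + f y]) = br' (X[i := f x]) + br' (X[i := f y])"
          using x y lin S.subspace_add[OF V] by (simp add: fadd[symmetric] eq linear_on_def)
      qed
    qed
  next
    fix X p assume "X \<in> tuples n W" and p: "p permutes {..<n}"
    then obtain xs where xs: "xs \<in> tuples n V" "X = map f xs" unfolding W tuples_image by auto
    have len: "length xs = n" using xs by (simp add: tuples_def)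
    have "permute_list p xs \<in> tuples n V" using xs p len by (simp add: tuples_def)
    then show "br' (permute_list p X) = t (of_int (sign p)) (br' X)"
      using br' skew[OF xs(1) p] xs p len brV[OF xs(1)]
      by (simp add: permute_list_map fscl)
  next
    fix X Y assume "X \<in> tuples (n - 1) W" "Y \<in> tuples n W"
    then obtain xs ys where xs: "xs \<in> tuples (n - 1) V" "X = map f xs"
      and ys: "ys \<in> tuples n V" "Y = map f ys" unfolding W tuples_image by auto
    have snoc: "xs @ [y] \<in> tuples n V" if "y \<in> V" for y
      using xs that n by (auto simp: tuples_def)
    have br_snoc: "br' (map f xs @ [f y]) = f (br (xs @ [y]))" if "y \<in> V" for y
      using br'[OF snoc[OF that]] by simp
    have upd: "ys[i := br (xs @ [ys ! i])] \<in> tuples n V" "ys ! i \<in> V" if "i < n" for i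
    proof -
      show "ys ! i \<in> V" using ys that by (auto simp: tuples_def)
      then show "ys[i := br (xs @ [ys ! i])] \<in> tuples n V"
        by (intro tuples_update ys brV snoc)
    qed
    have "br' (X @ [br' Y]) = (\<Sum>i<n. f (br (ys[i := br (xs @ [ys ! i])])))"
      using br_snoc[OF brV[OF ys(1)]] br'[OF ys(1)] jac[OF xs(1) ys(1)]
        fsum[of "{..<n}" "\<lambda>i. br (ys[i := br (xs @ [ys ! i])])"] brV upd xs ys
      by simp
    also have "\<dots> = (\<Sum>i<n. br' (Y[i := br' (X @ [Y ! i])]))"
    proof (rule sum.cong)
      fix i assume "i \<in> {..<n}"
      then have i: "i < n" "i < length ys" using ys by (auto simp: tuples_def)
      then show "f (br (ys[i := br (xs @ [ys ! i])])) = br' (Y[i := br' (X @ [Y ! i])])"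
        using br'[OF upd(1)[OF i(1)]] by (simp add: xs ys br_snoc upd(2) map_update)
    qed simp
    finally show "br' (X @ [br' Y]) = (\<Sum>i<n. br' (Y[i := br' (X @ [Y ! i])]))" .
  qed
qed

section \<open>The transposed operations\<close>

lemma transpose_cobracket_pure:
  assumes "x \<in> V" "\<gamma> x \<in> tensor_power n s V"
  shows "transpose_cobracket n s V \<gamma> (pure_tensor n fscale (dual_space s V) \<xi>s) x =
    \<gamma> x (\<lambda>xs. \<Prod>k<n. (\<xi>s ! k) (xs ! k))"
  using assms
  by (simp add: transpose_cobracket_def dual_map_def tensor_dual_def pairing_pure_tensor_left)

text \<open>
  The transpose is defined through the inverse of the identification \<open>(V\<^sup>*)\<^sup>\<otimes>\<^sup>n \<cong> (V\<^sup>\<otimes>\<^sup>n)\<^sup>*\<close>; the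
  second fact, its defining adjunction on pure tensors, characterises it by \<open>dual_tensor_eqI\<close>.
\<close>

lemma transpose_bracket:
  fixes s :: "'f::field \<Rightarrow> 'a::ab_group_add \<Rightarrow> 'a"
  assumes s: "vector_space s" and fin: "finite B" "V = module.span s B" and n: "0 < n"
    and \<mu>: "linear_on fscale (tensor_power n s V) s V \<mu>" and \<xi>: "\<xi> \<in> dual_space s V"
  shows transpose_bracket_in_tensor_power:
      "transpose_bracket n s V \<mu> \<xi> \<in> tensor_power n fscale (dual_space s V)"
    and transpose_bracket_eval: "\<And>xs. xs \<in> tuples n V \<Longrightarrow>
      transpose_bracket n s V \<mu> \<xi> (\<lambda>\<xi>s. \<Prod>k<n. (\<xi>s ! k) (xs ! k)) = \<xi> (\<mu> (pure_tensor n s V xs))"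
proof -
  let ?T = "tensor_power n s V" and ?TD = "tensor_power n fscale (dual_space s V)"
  let ?\<delta> = "transpose_bracket n s V \<mu> \<xi>"
  interpret P: vector_space "fscale :: 'f \<Rightarrow> (('a list \<Rightarrow> 'f) \<Rightarrow> 'f) \<Rightarrow> _"
    by (rule vector_space_fscale)
  have "P.subspace ?T" unfolding tensor_power_def by (rule P.subspace_span)
  then have "dual_map ?T \<mu> \<xi> \<in> tensor_dual n s V ` ?TD"
    using dual_map_in_dual_space[OF \<mu> \<xi> vector_space_fscale] tensor_dual_bij[OF s fin n]
    by (simp add: bij_betw_def)
  then have \<delta>: "?\<delta> \<in> ?TD" and td: "tensor_dual n s V ?\<delta> = dual_map ?T \<mu> \<xi>"
    unfolding transpose_bracket_def by (rule inv_into_into, rule f_inv_into_f)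
  show "?\<delta> \<in> ?TD" by (rule \<delta>)
  fix xs assume "xs \<in> tuples n V"
  then have pt: "pure_tensor n s V xs \<in> ?T"
    by (rule multilinear_on_mem[OF multilinear_pure_tensor _ n])
  have "?\<delta> (\<lambda>\<xi>s. \<Prod>k<n. (\<xi>s ! k) (xs ! k)) = pairing n ?\<delta> (pure_tensor n s V xs)"
    by (simp add: pairing_pure_tensor_right \<delta>)
  also have "\<dots> = tensor_dual n s V ?\<delta> (pure_tensor n s V xs)"
    using pt by (simp add: tensor_dual_def)
  also have "\<dots> = \<xi> (\<mu> (pure_tensor n s V xs))"
    using pt by (simp add: td dual_map_def)
  finally show "?\<delta> (\<lambda>\<xi>s. \<Prod>k<n. (\<xi>s ! k) (xs ! k)) = \<xi> (\<mu> (pure_tensor n s V xs))" .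
qed

lemma linear_on_transpose_bracket:
  fixes s :: "'f::field \<Rightarrow> 'a::ab_group_add \<Rightarrow> 'a"
  assumes s: "vector_space s" and fin: "finite B" "V = module.span s B" and n: "0 < n"
    and \<mu>: "linear_on fscale (tensor_power n s V) s V \<mu>"
  shows "linear_on fscale (dual_space s V) fscale (tensor_power n fscale (dual_space s V))
    (transpose_bracket n s V \<mu>)"
  unfolding linear_on_def
proof (intro conjI ballI allI)
  let ?D = "dual_space s V" and ?\<delta> = "transpose_bracket n s V \<mu>"
  interpret FD: vector_space "fscale :: 'f \<Rightarrow> ('a \<Rightarrow> 'f) \<Rightarrow> _" by (rule vector_space_fscale)
  interpret PD: vector_space "fscale :: 'f \<Rightarrow> ((('a \<Rightarrow> 'f) list \<Rightarrow> 'f) \<Rightarrow> 'f) \<Rightarrow> _"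
    by (rule vector_space_fscale)
  note \<delta>_in = transpose_bracket_in_tensor_power[OF assms]
    and \<delta> = transpose_bracket_eval[OF assms] and eqI = dual_tensor_eqI[OF s fin n]
  have subTD: "PD.subspace (tensor_power n fscale ?D)"
    unfolding tensor_power_def by (rule PD.subspace_span)
  fix \<xi> \<eta> c assume \<xi>: "\<xi> \<in> ?D"
  show "?\<delta> \<xi> \<in> tensor_power n fscale ?D" by (rule \<delta>_in[OF \<xi>])
  show "?\<delta> (fscale c \<xi>) = fscale c (?\<delta> \<xi>)"
    using \<xi> FD.subspace_scale[OF subspace_dual_space \<xi>]
    by (intro eqI PD.subspace_scale[OF subTD] \<delta>_in) (simp_all add: \<delta> fscale_apply)
  assume \<eta>: "\<eta> \<in> ?D"
  show "?\<delta> (\<xi> + \<eta>) = ?\<delta> \<xi> + ?\<delta> \<eta>"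
    using \<xi> \<eta> FD.subspace_add[OF subspace_dual_space \<xi> \<eta>]
    by (intro eqI PD.subspace_add[OF subTD] \<delta>_in) (simp_all add: \<delta>)
qed

text \<open>
  Evaluation \<open>x \<mapsto> (\<xi> \<mapsto> \<xi> x)\<close> maps \<open>V\<close> onto its bidual and intertwines \<open>\<mu>\<close> with the bracket
  induced by its transpose.
\<close>

lemma n_lie_algebra_bidual:
  fixes s :: "'f::field \<Rightarrow> 'a::ab_group_add \<Rightarrow> 'a"
  assumes s: "vector_space s" and fin: "finite B" "V = module.span s B" and n: "0 < n"
    and \<mu>: "linear_on fscale (tensor_power n s V) s V \<mu>"
    and L: "n_lie_algebra n s V (\<lambda>xs. \<mu> (pure_tensor n s V xs))"
  shows "n_lie_algebra n fscale (dual_space fscale (dual_space s V))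
    (\<lambda>\<Phi>s. transpose_cobracket n fscale (dual_space s V) (transpose_bracket n s V \<mu>)
       (pure_tensor n fscale (dual_space fscale (dual_space s V)) \<Phi>s))"
proof -
  let ?D = "dual_space s V" and ?\<delta> = "transpose_bracket n s V \<mu>"
  let ?DD = "dual_space fscale ?D"
  interpret FD: vector_space "fscale :: 'f \<Rightarrow> ('a \<Rightarrow> 'f) \<Rightarrow> _" by (rule vector_space_fscale)
  note \<delta>_in = transpose_bracket_in_tensor_power[OF s fin n \<mu>]
  \<comment> \<open>Elements of a dual space vanish off the space, hence the cut-off outside \<open>?D\<close>.\<close>
  define ev where "ev x = (\<lambda>\<xi>. if \<xi> \<in> ?D then \<xi> x else 0)" for x
  have D_lin: "linear_on s V (*) UNIV \<xi>" if "\<xi> \<in> ?D" for \<xi>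
    using that by (simp add: dual_space_def)
  have ev_in: "ev x \<in> ?DD" for x
    using FD.subspace_add[OF subspace_dual_space] FD.subspace_scale[OF subspace_dual_space]
    by (simp add: ev_def dual_space_def[of fscale] linear_on_def fscale_apply)
  have ev_lin: "linear_on s V fscale ?DD ev"
    using ev_in D_lin by (auto simp: linear_on_def ev_def fun_eq_iff fscale_apply)
  have ev_surj: "?DD = ev ` V"
  proof (intro equalityI subsetI)
    fix \<Phi> assume \<Phi>: "\<Phi> \<in> ?DD"
    then have "linear_on fscale ?D (*) UNIV \<Phi>" by (simp add: dual_space_def[of fscale])
    then obtain z where z: "z \<in> V" "\<And>\<xi>. \<xi> \<in> ?D \<Longrightarrow> \<Phi> \<xi> = \<xi> z"
      by (rule bidual_is_evaluation[OF s fin]) blast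
    then have "\<Phi> = ev z" using \<Phi> by (auto simp: ev_def fun_eq_iff dual_space_def[of fscale])
    then show "\<Phi> \<in> ev ` V" using z(1) by blast
  qed (use ev_in in auto)
  show ?thesis
  proof (rule n_lie_algebra_image[OF L n vector_space_fscale ev_lin ev_surj], rule ext)
    fix xs \<xi> assume xs: "xs \<in> tuples n V"
    show "transpose_cobracket n fscale ?D ?\<delta> (pure_tensor n fscale ?DD (map ev xs)) \<xi> =
        ev (\<mu> (pure_tensor n s V xs)) \<xi>"
    proof (cases "\<xi> \<in> ?D")
      case True
      have "transpose_cobracket n fscale ?D ?\<delta> (pure_tensor n fscale ?DD (map ev xs)) \<xi> =
          ?\<delta> \<xi> (\<lambda>\<xi>s. \<Prod>k<n. (map ev xs ! k) (\<xi>s ! k))"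
        by (rule transpose_cobracket_pure[where \<gamma> = ?\<delta>, OF True \<delta>_in[OF True]])
      also have "\<dots> = ?\<delta> \<xi> (\<lambda>\<xi>s. \<Prod>k<n. (\<xi>s ! k) (xs ! k))"
      proof (rule tensor_power_cong[OF vector_space_fscale subspace_dual_space \<delta>_in[OF True]])
        fix \<xi>s assume "\<xi>s \<in> tuples n ?D"
        then have "\<xi>s ! k \<in> ?D" if "k < n" for k using that by (auto simp: tuples_def)
        then show "(\<Prod>k<n. (map ev xs ! k) (\<xi>s ! k)) = (\<Prod>k<n. (\<xi>s ! k) (xs ! k))"
          using xs by (intro prod.cong) (auto simp: ev_def tuples_def)
      qed
      also have "\<dots> = ev (\<mu> (pure_tensor n s V xs)) \<xi>"
        using transpose_bracket_eval[OF s fin n \<mu> True xs] True by (simp add: ev_def)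
      finally show ?thesis .
    qed (simp add: ev_def transpose_cobracket_def dual_map_def)
  qed
qed

section \<open>The cocycle identity\<close>

text \<open>
  Applied to a product of functionals, the action of \<open>D\<close> on the factor \<open>j\<close> replaces \<open>\<xi>\<^sub>j\<close> by
  \<open>\<xi>\<^sub>j \<circ> D\<close>. The hypothesis on \<open>brD\<close> reads the resulting value of \<open>T\<close> as a value of the dual bracket,
  in which skew-symmetry brings \<open>\<xi>\<^sub>j \<circ> D\<close> into the last position.
\<close>

lemma tensor_action_form:
  assumes s: "vector_space s" and V: "module.subspace s V"
    and LD: "n_lie_algebra n fscale (dual_space s V) brD"
    and T: "T \<in> tensor_power n s V"
    and brD: "\<And>\<xi>s. \<xi>s \<in> tuples n (dual_space s V) \<Longrightarrow>
      brD \<xi>s x = T (\<lambda>xs. \<Prod>k<n. (\<xi>s ! k) (xs ! k))"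
    and D: "linear_on s V s V D" and \<xi>s: "\<xi>s \<in> tuples n (dual_space s V)"
  shows "tensor_action n s V D T (\<lambda>xs. \<Prod>k<n. (\<xi>s ! k) (xs ! k)) =
    (\<Sum>j<n. (-1) ^ (n - Suc j) * ad_omit brD j \<xi>s (dual_map V D (\<xi>s ! j)) x)"
proof -
  have "T (\<lambda>ys. \<Prod>k<n. (\<xi>s ! k) (ys[j := D (ys ! j)] ! k)) =
      (-1) ^ (n - Suc j) * ad_omit brD j \<xi>s (dual_map V D (\<xi>s ! j)) x" if j: "j < n" for j
  proof -
    let ?\<eta> = "dual_map V D (\<xi>s ! j)"
    have "\<xi>s ! j \<in> dual_space s V" using \<xi>s j by (auto simp: tuples_def)
    then have \<eta>: "?\<eta> \<in> dual_space s V" by (rule dual_map_in_dual_space[OF D _ s V])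
    have "T (\<lambda>ys. \<Prod>k<n. (\<xi>s ! k) (ys[j := D (ys ! j)] ! k)) =
        T (\<lambda>ys. \<Prod>k<n. (\<xi>s[j := ?\<eta>] ! k) (ys ! k))"
    proof (rule tensor_power_cong[OF s V T])
      fix ys assume ys: "ys \<in> tuples n V"
      then have "ys ! j \<in> V" "length ys = n" "length \<xi>s = n"
        using \<xi>s j by (auto simp: tuples_def)
      then show "(\<Prod>k<n. (\<xi>s ! k) (ys[j := D (ys ! j)] ! k)) = (\<Prod>k<n. (\<xi>s[j := ?\<eta>] ! k) (ys ! k))"
        using j by (intro prod.cong) (auto simp: nth_list_update dual_map_def)
    qed
    also have "\<dots> = brD (\<xi>s[j := ?\<eta>]) x" using brD tuples_update[OF \<xi>s \<eta>] by simp
    also have "\<dots> = (-1) ^ (n - Suc j) * ad_omit brD j \<xi>s ?\<eta> x"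
      by (simp add: n_lie_algebra_update[OF LD \<xi>s \<eta> j] fscale_apply)
    finally show ?thesis .
  qed
  then show ?thesis
    using multilinear_on_prod_functionals[OF \<xi>s] by (simp add: tensor_action_def)
qed

text \<open>
  The counterpart on the dual side. By reflexivity the linear form \<open>\<eta> \<mapsto> A \<eta> (x\<^sub>j)\<close> is evaluation
  at a vector \<open>z\<close>, which takes the place of \<open>x\<^sub>j\<close> and moves to the end of the bracket by
  skew-symmetry; the result is the value
  at \<open>z\<close> of a functional \<open>\<eta>\<close>, that is \<open>A \<eta> (x\<^sub>j)\<close> again.
\<close>

lemma tensor_action_dual_form:
  fixes s :: "'f::field \<Rightarrow> 'a::ab_group_add \<Rightarrow> 'a"
  assumes s: "vector_space s" and fin: "finite B" "V = module.span s B"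
    and L: "n_lie_algebra n s V br"
    and S: "S \<in> tensor_power n fscale (dual_space s V)" and \<xi>: "\<xi> \<in> dual_space s V"
    and br: "\<And>xs. xs \<in> tuples n V \<Longrightarrow> S (\<lambda>\<eta>s. \<Prod>k<n. (\<eta>s ! k) (xs ! k)) = \<xi> (br xs)"
    and A: "linear_on fscale (dual_space s V) fscale (dual_space s V) A" and xs: "xs \<in> tuples n V"
  shows "tensor_action n fscale (dual_space s V) A S (\<lambda>\<eta>s. \<Prod>k<n. (\<eta>s ! k) (xs ! k)) =
    (\<Sum>j<n. (-1) ^ (n - Suc j) * A (dual_map V (ad_omit br j xs) \<xi>) (xs ! j))"
proof -
  let ?D = "dual_space s V"
  have V: "module.subspace s V" using L by (simp add: n_lie_algebra_def)
  have "S (\<lambda>\<eta>s. \<Prod>k<n. (\<eta>s[j := A (\<eta>s ! j)] ! k) (xs ! k)) =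
      (-1) ^ (n - Suc j) * A (dual_map V (ad_omit br j xs) \<xi>) (xs ! j)" if j: "j < n" for j
  proof -
    note ad = linear_on_ad_omit[OF L xs j]
    have "linear_on fscale ?D (*) UNIV (\<lambda>\<eta>. A \<eta> (xs ! j))"
      using A by (auto simp: linear_on_def fscale_apply)
    then obtain z where z: "z \<in> V" "\<And>\<eta>. \<eta> \<in> ?D \<Longrightarrow> A \<eta> (xs ! j) = \<eta> z"
      by (rule bidual_is_evaluation[OF s fin]) blast
    have "S (\<lambda>\<eta>s. \<Prod>k<n. (\<eta>s[j := A (\<eta>s ! j)] ! k) (xs ! k)) =
        S (\<lambda>\<eta>s. \<Prod>k<n. (\<eta>s ! k) (xs[j := z] ! k))"
    proof (rule tensor_power_cong[OF vector_space_fscale subspace_dual_space S])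
      fix \<eta>s assume \<eta>s: "\<eta>s \<in> tuples n ?D"
      then have "\<eta>s ! j \<in> ?D" "length \<eta>s = n" "length xs = n"
        using xs j by (auto simp: tuples_def)
      then show "(\<Prod>k<n. (\<eta>s[j := A (\<eta>s ! j)] ! k) (xs ! k)) = (\<Prod>k<n. (\<eta>s ! k) (xs[j := z] ! k))"
        using z(2) j by (intro prod.cong) (auto simp: nth_list_update)
    qed
    also have "\<dots> = \<xi> (br (xs[j := z]))" by (rule br[OF tuples_update[OF xs z(1)]])
    also have "\<dots> = \<xi> (s ((-1) ^ (n - Suc j)) (ad_omit br j xs z))"
      by (simp add: n_lie_algebra_update[OF L xs z(1) j])
    also have "\<dots> = (-1) ^ (n - Suc j) * \<xi> (ad_omit br j xs z)"
      using \<xi> ad z(1) by (simp add: linear_on_def dual_space_def)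
    also have "\<xi> (ad_omit br j xs z) = dual_map V (ad_omit br j xs) \<xi> z"
      using z(1) by (simp add: dual_map_def)
    also have "\<dots> = A (dual_map V (ad_omit br j xs) \<xi>) (xs ! j)"
      by (rule z(2)[symmetric, OF dual_map_in_dual_space[OF ad \<xi> s V]])
    finally show ?thesis .
  qed
  then show ?thesis
    using multilinear_on_prod_arguments[OF xs, where s = s] by (simp add: tensor_action_def)
qed

theorem proposition3p8:
  fixes n :: nat
    and s :: "'f::field_char_0 \<Rightarrow> 'a::ab_group_add \<Rightarrow> 'a"
    and V :: "'a set"
    and \<mu> :: "(('a list \<Rightarrow> 'f) \<Rightarrow> 'f) \<Rightarrow> 'a"
    and \<gamma> :: "'a \<Rightarrow> ('a list \<Rightarrow> 'f) \<Rightarrow> 'f"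
  assumes "n \<ge> 2"
    and "vector_space s" and "module.subspace s V"
    and "\<exists>B. finite B \<and> V = module.span s B"
    and "linear_on fscale (tensor_power n s V) s V \<mu>"
    and "n_lie_bialgebra n s V (\<lambda>xs. \<mu> (pure_tensor n s V xs)) \<gamma>"
  shows "n_lie_bialgebra n fscale (dual_space s V)
           (\<lambda>\<xi>s. transpose_cobracket n s V \<gamma> (pure_tensor n fscale (dual_space s V) \<xi>s))
           (transpose_bracket n s V \<mu>)"
proof -
  let ?D = "dual_space s V" and ?\<delta> = "transpose_bracket n s V \<mu>"
  let ?TD = "tensor_power n fscale ?D"
  let ?ev = "\<lambda>xs \<xi>s. \<Prod>k<n. (\<xi>s ! k) (xs ! k) :: 'f"
  define br where "br xs = \<mu> (pure_tensor n s V xs)" for xs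
  define brD where "brD \<xi>s = transpose_cobracket n s V \<gamma> (pure_tensor n fscale ?D \<xi>s)" for \<xi>s
  define sg where "sg i = ((-1) ^ (n - Suc i) :: 'f)" for i
  note s = assms(2) and V = assms(3) and \<mu> = assms(5)
  obtain B where B: "finite B" "V = module.span s B" using assms(4) by blast
  have n: "0 < n" using assms(1) by simp
  interpret PD: vector_space "fscale :: 'f \<Rightarrow> ((('a \<Rightarrow> 'f) list \<Rightarrow> 'f) \<Rightarrow> 'f) \<Rightarrow> _"
    by (rule vector_space_fscale)
  note bial = assms(6)[unfolded n_lie_bialgebra_def, folded br_def brD_def]
  have L: "n_lie_algebra n s V br" and LD: "n_lie_algebra n fscale ?D brD"
    and \<gamma>: "linear_on s V fscale (tensor_power n s V) \<gamma>"
    and cocycle: "\<And>xs. xs \<in> tuples n V \<Longrightarrow> \<gamma> (br xs) =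
      (\<Sum>i<n. fscale (sg i) (tensor_action n s V (ad_omit br i xs) (\<gamma> (xs ! i))))"
    using bial by (simp_all add: br_def[abs_def] brD_def[abs_def] sg_def ad_omit_def)
  have \<gamma>T: "\<gamma> x \<in> tensor_power n s V" if "x \<in> V" for x using \<gamma> that by (simp add: linear_on_def)
  have brD: "brD \<xi>s x = \<gamma> x (\<lambda>xs. ?ev xs \<xi>s)" if "x \<in> V" for \<xi>s x
    using transpose_cobracket_pure[where \<gamma> = \<gamma>, OF that \<gamma>T[OF that]] by (simp add: brD_def)
  note \<delta>_in = transpose_bracket_in_tensor_power[OF s B n \<mu>]
    and \<delta> = transpose_bracket_eval[OF s B n \<mu>, folded br_def]
  have "?\<delta> (brD \<xi>s) = (\<Sum>i<n. fscale (sg i) (tensor_action n fscale ?D (ad_omit brD i \<xi>s) (?\<delta> (\<xi>s ! i))))"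
    if \<xi>s: "\<xi>s \<in> tuples n ?D" for \<xi>s
  proof (rule dual_tensor_eqI[OF s B n])
    have mem: "\<xi>s ! i \<in> ?D" if "i < n" for i using \<xi>s that by (auto simp: tuples_def)
    have brD_in: "brD \<xi>s \<in> ?D"
      using LD \<xi>s n by (auto simp: n_lie_algebra_def intro: multilinear_on_mem)
    then show "?\<delta> (brD \<xi>s) \<in> ?TD" by (rule \<delta>_in)
    have "tensor_action n fscale ?D (ad_omit brD i \<xi>s) (?\<delta> (\<xi>s ! i)) \<in> ?TD" if "i < n" for i
      by (rule tensor_action_in_tensor_power[OF linear_on_ad_omit[OF LD \<xi>s that] \<delta>_in[OF mem[OF that]]])
    then show "(\<Sum>i<n. fscale (sg i) (tensor_action n fscale ?D (ad_omit brD i \<xi>s) (?\<delta> (\<xi>s ! i)))) \<in> ?TD"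
      unfolding tensor_power_def by (intro PD.span_sum PD.span_scale) auto
    fix xs assume xs: "xs \<in> tuples n V"
    then have br_in: "br xs \<in> V"
      using L n by (auto simp: n_lie_algebra_def intro: multilinear_on_mem)
    \<comment> \<open>The terms \<open>X i j\<close> are common to both sides, which sum them in opposite orders.\<close>
    define X where
      "X i j = ad_omit brD j \<xi>s (dual_map V (ad_omit br i xs) (\<xi>s ! j)) (xs ! i)" for i j
    have "?\<delta> (brD \<xi>s) (?ev xs) = \<gamma> (br xs) (\<lambda>xs. ?ev xs \<xi>s)"
      by (simp add: \<delta>[OF brD_in xs] brD br_in)
    also have "\<dots> = (\<Sum>i<n. sg i * tensor_action n s V (ad_omit br i xs) (\<gamma> (xs ! i)) (\<lambda>xs. ?ev xs \<xi>s))"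
      by (simp add: cocycle[OF xs] sum_fun_apply fscale_apply)
    also have "\<dots> = (\<Sum>i<n. sg i * (\<Sum>j<n. sg j * X i j))"
    proof (rule sum.cong[OF refl])
      fix i assume "i \<in> {..<n}"
      then have i: "i < n" "xs ! i \<in> V" using xs by (auto simp: tuples_def)
      show "sg i * tensor_action n s V (ad_omit br i xs) (\<gamma> (xs ! i)) (\<lambda>xs. ?ev xs \<xi>s) =
          sg i * (\<Sum>j<n. sg j * X i j)"
        using tensor_action_form[OF s V LD \<gamma>T[OF i(2)] brD[OF i(2)] linear_on_ad_omit[OF L xs i(1)] \<xi>s]
        by (simp add: X_def sg_def)
    qed
    also have "\<dots> = (\<Sum>i<n. \<Sum>j<n. sg i * (sg j * X j i))"
      unfolding sum_distrib_left by (subst sum.swap) (simp add: mult.left_commute)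
    also have "\<dots> = (\<Sum>i<n. sg i * tensor_action n fscale ?D (ad_omit brD i \<xi>s) (?\<delta> (\<xi>s ! i)) (?ev xs))"
    proof (rule sum.cong[OF refl])
      fix i assume "i \<in> {..<n}"
      then have i: "i < n" by simp
      show "(\<Sum>j<n. sg i * (sg j * X j i)) =
          sg i * tensor_action n fscale ?D (ad_omit brD i \<xi>s) (?\<delta> (\<xi>s ! i)) (?ev xs)"
        using tensor_action_dual_form[OF s B L \<delta>_in[OF mem[OF i]] mem[OF i] \<delta>[OF mem[OF i]]
            linear_on_ad_omit[OF LD \<xi>s i] xs]
        by (simp add: X_def sg_def sum_distrib_left)
    qed
    finally show "?\<delta> (brD \<xi>s) (?ev xs) =
        (\<Sum>i<n. fscale (sg i) (tensor_action n fscale ?D (ad_omit brD i \<xi>s) (?\<delta> (\<xi>s ! i)))) (?ev xs)"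
      by (simp add: sum_fun_apply fscale_apply)
  qed
  with LD linear_on_transpose_bracket[OF s B n \<mu>]
    n_lie_algebra_bidual[OF s B n \<mu> L[unfolded br_def[abs_def]]]
  show ?thesis
    unfolding n_lie_bialgebra_def brD_def ad_omit_def sg_def by blast
qed

end
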